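(* Let $\mathcal G$ be a groupoid, $G$ a locally compact group, $N<G$ a closed normal subgroup, and $\bar\rho:\mathcal G\to G/N$ a homomorphism that admits a continuous lift $\rho:\mathcal G\to G$. Form the groupoids $$\mathcal H:=G\ltimes(G/N\rtimes_{\bar\rho}\mathcal G),\qquad \mathcal K:=N\rtimes^{\delta\rho}\mathcal G .$$ Then for any $G$-equivariant 2-cocycle $(\sigma,\lambda,\beta)\in Z^2_G(G/N\rtimes_{\bar\rho}\mathcal G;U(1))$ there is a Morita equivalence of twisted groupoids $(\mathcal H,\psi)\sim(\mathcal K,\chi)$, where $\psi\in Z^2(\mathcal H;U(1))$ and $\chi\in Z^2(\mathcal K;U(1))$ are given by $$\psi((g_1,t,\gamma_1),(g_2,g_1^{-1}t\rho(\gamma_1),\gamma_2)):=\sigma(t,\gamma_1,\gamma_2)\,\lambda(g_1,t\rho(\gamma_1),\gamma_2)\,\beta(g_1,g_2,t\rho(\gamma_1)\rho(\gamma_2),s\gamma_2),$$ $$\chi((n_1,\gamma_1),(n_2,\gamma_2)):=\sigma(e_{G/N},\gamma_1,\gamma_2)\,\lambda(n_1\rho(\gamma_1),\rho(\gamma_1),\gamma_2)\,\beta(n_1\rho(\gamma_1),n_2\rho(\gamma_2),\rho(\gamma_1)\rho(\gamma_2),s\gamma_2),$$ for $g_i\in G$, $t\in G/N$, $n_i\in N$, $\gamma_i\in\mathcal G$ (elements of $G$ appearing in a $G/N$-slot stand for their cosets).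
   Context: A groupoid $\mathcal G=(\mathcal G_1\rightrightarrows\mathcal G_0)$ is a topological groupoid with source $s$ and range $r$ (the product $\gamma_1\gamma_2$ is defined when $s\gamma_1=r\gamma_2$), whose arrow space is locally compact Hausdorff and second countable, equipped with a left Haar system; $\mathcal G_k$ is the space of composable $k$-tuples. $\mathcal M:=G/N\rtimes_{\bar\rho}\mathcal G=(G/N\times\mathcal G_1\rightrightarrows G/N\times\mathcal G_0)$ has $s(t,\gamma)=(t\bar\rho(\gamma),s\gamma)$, $r(t,\gamma)=(t,r\gamma)$, $(t,\gamma_1)(t\bar\rho(\gamma_1),\gamma_2)=(t,\gamma_1\gamma_2)$ and left $G$-translation. A composable pair or tuple is written by its first $G/N$-coordinate and $\gamma$'s, e.g. $\sigma(t,\gamma_1,\gamma_2)=\sigma((t,\gamma_1),(t\bar\rho(\gamma_1),\gamma_2))$. $\mathcal H$ has arrows $(g,t,\gamma)$, $s(g,t,\gamma)=(g^{-1}t\rho(\gamma),s\gamma)$, $r(g,t,\gamma)=(t,r\gamma)$, $(g_1,t,\gamma_1)(g_2,g_1^{-1}t\rho(\gamma_1),\gamma_2)=(g_1g_2,t,\gamma_1\gamma_2)$. With $\delta\rho(\gamma_1,\gamma_2)=\rho(\gamma_1)\rho(\gamma_2)\rho(\gamma_1\gamma_2)^{-1}\in N$, $\mathcal K=(N\times\mathcal G_1\rightrightarrows\mathcal G_0)$ has product $(n_1,\gamma_1)(n_2,\gamma_2)=(n_1\rho(\gamma_1)n_2\rho(\gamma_1)^{-1}\delta\rho(\gamma_1,\gamma_2),\gamma_1\gamma_2)$.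 Cochains: $C^k(\mathcal G;U(1))$ is the group of continuous maps $\mathcal G_k\to U(1)$ (for $k\ge1$ trivial when an entry is a unit), with $\delta f(\gamma_1,\dots,\gamma_{k+1})=f(\gamma_2,\dots)\prod_{i=1}^kf(\dots,\gamma_i\gamma_{i+1},\dots)^{(-1)^i}f(\gamma_1,\dots,\gamma_k)^{(-1)^{k+1}}$ (for $k=0$: $\delta f(\gamma)=f(s\gamma)f(r\gamma)^{-1}$). For a $G$-groupoid $\mathcal M$, $G$ acts by $(g\cdot f)(h_1,\dots)=f(g^{-1}h_1,\dots)$, $d$ is the group cochain differential of $G$, and $Z^2_G(\mathcal M;U(1))$ is the set of triples of continuous functions $\sigma\in C^2(\mathcal M;U(1))$, $\lambda\in C^1(G;C^1(\mathcal M;U(1)))$ (a function $\lambda(g,h)$), $\beta\in C^2(G;C^0(\mathcal M;U(1)))$ (a function $\beta(g_1,g_2,x)$) with $\delta\sigma=1$, $d\sigma=\delta\lambda$, $\delta\beta\,d\lambda=1$, $d\beta=1$. A Morita equivalence $(\mathcal H$-$\mathcal K)$-bimodule is a space $P$ with commuting free and proper left $\mathcal H$- and right $\mathcal K$-actions whose moment maps induce homeomorphisms $P/\mathcal K\cong\mathcal H_0$, $\mathcal H\backslash P\cong\mathcal K_0$. Twisted groupoids $(\mathcal H,\psi)$, $(\mathcal K,\chi)$ are Morita equivalent if there is such a $P$ for which $\psi$ and $\chi$ are cohomologous, i.e. there are continuous $\mu:\mathcal H_1\times_{\mathcal H_0}P\to U(1)$ and $\nu:P\times_{\mathcal K_0}\mathcal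 K_1\to U(1)$ with $\mu(h_2,p)\mu(h_1h_2,p)^{-1}\mu(h_1,h_2p)=\psi(h_1,h_2)$, $\nu(pk_1,k_2)\nu(p,k_1k_2)^{-1}\nu(p,k_1)=\chi(k_1,k_2)$ and $\mu(h,p)\nu(hp,k)=\nu(p,k)\mu(h,pk)$. (Equivalently, $\psi$ and $\chi$ have cohomologous images in the total complex of the double complex of $U(1)$-valued functions on $\mathcal H_j\times_{\mathcal H_0}P\times_{\mathcal K_0}\mathcal K_i$.) *)

theory Defs
  imports "HOL-Analysis.Analysis" "HOL-Algebra.Coset"
begin

section \<open>Quotient topologies\<close>

definition quotient_topology :: "'a topology \<Rightarrow> ('a \<Rightarrow> 'b) \<Rightarrow> 'b topology" where
  "quotient_topology X q =
     topology (\<lambda>U. U \<subseteq> q ` topspace X \<and> openin X {x \<in> topspace X. q x \<in> U})"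

lemma openin_quotient_topology:
  "openin (quotient_topology X q) U \<longleftrightarrow>
     U \<subseteq> q ` topspace X \<and> openin X {x \<in> topspace X. q x \<in> U}"
proof -
  let ?P = "\<lambda>U. U \<subseteq> q ` topspace X \<and> openin X {x \<in> topspace X. q x \<in> U}"
  have "?P (S \<inter> T)" if "?P S" "?P T" for S T
  proof -
    have "{x \<in> topspace X. q x \<in> S \<inter> T} =
        {x \<in> topspace X. q x \<in> S} \<inter> {x \<in> topspace X. q x \<in> T}"
      by auto
    with that show ?thesis by (auto intro: openin_Int)
  qed
  moreover have "?P (\<Union>\<K>)" if "\<forall>S\<in>\<K>. ?P S" for \<K>
  proof -
    have "{x \<in> topspace X. q x \<in> \<Union>\<K>} = (\<Union>S\<in>\<K>. {x \<in> topspace X. q x \<in> S})"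
      by auto
    with that show ?thesis by (auto intro!: openin_Union)
  qed
  ultimately have "istopology ?P"
    unfolding istopology_def by blast
  then show ?thesis
    by (simp add: quotient_topology_def topology_inverse')
qed

lemma topspace_quotient_topology: "topspace (quotient_topology X q) = q ` topspace X"
proof
  show "topspace (quotient_topology X q) \<subseteq> q ` topspace X"
    by (metis openin_quotient_topology openin_topspace)
  have "{x \<in> topspace X. q x \<in> q ` topspace X} = topspace X"
    by auto
  then have "openin (quotient_topology X q) (q ` topspace X)"
    by (simp add: openin_quotient_topology)
  then show "q ` topspace X \<subseteq> topspace (quotient_topology X q)"
    by (rule openin_subset)
qed

lemma quotient_map_quotient_topology: "quotient_map X (quotient_topology X q) q"
  by (auto simp: quotient_map_def openin_quotient_topology topspace_quotient_topology)


section \<open>Topological groups\<close>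

record 'g top_group = "'g monoid" +
  grp_top :: "'g topology"

locale locally_compact_group = group G for G :: "'g top_group" (structure) +
  assumes topspace_grp: "topspace (grp_top G) = carrier G"
    and mult_continuous:
      "continuous_map (prod_topology (grp_top G) (grp_top G)) (grp_top G) (\<lambda>(g, h). g \<otimes> h)"
    and inv_continuous: "continuous_map (grp_top G) (grp_top G) (\<lambda>g. inv g)"
    and Hausdorff_grp: "Hausdorff_space (grp_top G)"
    and locally_compact_grp: "locally_compact_space (grp_top G)"

text \<open>The topology of \<open>G/N\<close>, whose underlying set is the carrier of \<^term>\<open>G Mod N\<close>.\<close>

definition coset_top :: "'g top_group \<Rightarrow> 'g set \<Rightarrow> 'g set topology" where
  "coset_top G N = quotient_topology (grp_top G) (\<lambda>g. N #>\<^bsub>G\<^esub> g)"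


section \<open>Topological groupoids\<close>

record ('o, 'a) groupoid =
  obj_top :: "'o topology"
  arr_top :: "'a topology"
  src :: "'a \<Rightarrow> 'o"
  rng :: "'a \<Rightarrow> 'o"
  ident :: "'o \<Rightarrow> 'a"
  ginv :: "'a \<Rightarrow> 'a"
  gmult :: "'a \<Rightarrow> 'a \<Rightarrow> 'a"

abbreviation objs :: "('o, 'a) groupoid \<Rightarrow> 'o set" where
  "objs \<G> \<equiv> topspace (obj_top \<G>)"

abbreviation arrows :: "('o, 'a) groupoid \<Rightarrow> 'a set" where
  "arrows \<G> \<equiv> topspace (arr_top \<G>)"

definition composable2 :: "('o, 'a) groupoid \<Rightarrow> ('a \<times> 'a) topology" where
  "composable2 \<G> =
     subtopology (prod_topology (arr_top \<G>) (arr_top \<G>)) {(a, b). src \<G> a = rng \<G> b}"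

definition composable3 :: "('o, 'a) groupoid \<Rightarrow> ('a \<times> 'a \<times> 'a) topology" where
  "composable3 \<G> =
     subtopology (prod_topology (arr_top \<G>) (prod_topology (arr_top \<G>) (arr_top \<G>)))
       {(a, b, c). src \<G> a = rng \<G> b \<and> src \<G> b = rng \<G> c}"

locale topological_groupoid =
  fixes \<G> :: "('o, 'a) groupoid"
  assumes src_continuous: "continuous_map (arr_top \<G>) (obj_top \<G>) (src \<G>)"
    and rng_continuous: "continuous_map (arr_top \<G>) (obj_top \<G>) (rng \<G>)"
    and ident_continuous: "continuous_map (obj_top \<G>) (arr_top \<G>) (ident \<G>)"
    and ginv_continuous: "continuous_map (arr_top \<G>) (arr_top \<G>) (ginv \<G>)"
    and gmult_continuous:
      "continuous_map (composable2 \<G>) (arr_top \<G>) (\<lambda>(a, b). gmult \<G> a b)"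
    and src_ident: "x \<in> objs \<G> \<Longrightarrow> src \<G> (ident \<G> x) = x"
    and rng_ident: "x \<in> objs \<G> \<Longrightarrow> rng \<G> (ident \<G> x) = x"
    and src_gmult: "(a, b) \<in> topspace (composable2 \<G>) \<Longrightarrow> src \<G> (gmult \<G> a b) = src \<G> b"
    and rng_gmult: "(a, b) \<in> topspace (composable2 \<G>) \<Longrightarrow> rng \<G> (gmult \<G> a b) = rng \<G> a"
    and gmult_assoc: "(a, b, c) \<in> topspace (composable3 \<G>) \<Longrightarrow>
      gmult \<G> (gmult \<G> a b) c = gmult \<G> a (gmult \<G> b c)"
    and ident_left: "a \<in> arrows \<G> \<Longrightarrow> gmult \<G> (ident \<G> (rng \<G> a)) a = a"
    and ident_right: "a \<in> arrows \<G> \<Longrightarrow> gmult \<G> a (ident \<G> (src \<G> a)) = a"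
    and src_ginv: "a \<in> arrows \<G> \<Longrightarrow> src \<G> (ginv \<G> a) = rng \<G> a"
    and rng_ginv: "a \<in> arrows \<G> \<Longrightarrow> rng \<G> (ginv \<G> a) = src \<G> a"
    and ginv_left: "a \<in> arrows \<G> \<Longrightarrow> gmult \<G> (ginv \<G> a) a = ident \<G> (src \<G> a)"
    and ginv_right: "a \<in> arrows \<G> \<Longrightarrow> gmult \<G> a (ginv \<G> a) = ident \<G> (rng \<G> a)"

locale locally_compact_groupoid = topological_groupoid +
  assumes Hausdorff_arr: "Hausdorff_space (arr_top \<G>)"
    and locally_compact_arr: "locally_compact_space (arr_top \<G>)"

definition compactly_supported :: "'a topology \<Rightarrow> ('a \<Rightarrow> complex) set" where
  "compactly_supported X =
     {f. continuous_map X euclidean f \<and>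
         (\<exists>C. compactin X C \<and> (\<forall>x \<in> topspace X - C. f x = 0))}"

definition measure_support :: "'a topology \<Rightarrow> 'a measure \<Rightarrow> 'a set" where
  "measure_support X \<mu> = {x \<in> topspace X. \<forall>U. openin X U \<and> x \<in> U \<longrightarrow> emeasure \<mu> U > 0}"

text \<open>
  A left Haar system \<open>(haar x)\<close>, indexed by the objects: Radon measures with support the range
  fibres, continuous in \<open>x\<close> and left invariant.  On a second countable locally compact
  Hausdorff space a Borel measure that is finite on compact sets is automatically Radon.
\<close>

locale haar_groupoid = locally_compact_groupoid +
  fixes haar :: "'a \<Rightarrow> 'b measure"
  assumes second_countable_arr: "second_countable (arr_top \<G>)"
    and space_haar: "x \<in> objs \<G> \<Longrightarrow> space (haar x) = arrows \<G>"
    and sets_haar: "x \<in> objs \<G> \<Longrightarrow> sets (haar x) = sigma_sets (arrows \<G>) {U. openin (arr_top \<G>) U}"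
    and finite_haar: "\<lbrakk>x \<in> objs \<G>; compactin (arr_top \<G>) C\<rbrakk> \<Longrightarrow> emeasure (haar x) C < \<infinity>"
    and support_haar: "x \<in> objs \<G> \<Longrightarrow>
      measure_support (arr_top \<G>) (haar x) = {a \<in> arrows \<G>. rng \<G> a = x}"
    and haar_continuous: "f \<in> compactly_supported (arr_top \<G>) \<Longrightarrow>
      continuous_map (obj_top \<G>) euclidean (\<lambda>x. LINT a|haar x. f a)"
    and haar_left_invariant: "\<lbrakk>a \<in> arrows \<G>; f \<in> compactly_supported (arr_top \<G>)\<rbrakk> \<Longrightarrow>
      (LINT b:{b \<in> arrows \<G>. rng \<G> b = src \<G> a}|haar (src \<G> a). f (gmult \<G> a b)) =
      (LINT b|haar (rng \<G> a). f b)"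

definition groupoid_to_group_hom ::
  "('o, 'a) groupoid \<Rightarrow> 'q monoid \<Rightarrow> 'q topology \<Rightarrow> ('a \<Rightarrow> 'q) \<Rightarrow> bool" where
  "groupoid_to_group_hom \<G> Q TQ \<phi> \<longleftrightarrow>
     continuous_map (arr_top \<G>) TQ \<phi> \<and>
     (\<forall>(a, b) \<in> topspace (composable2 \<G>). \<phi> (gmult \<G> a b) = \<phi> a \<otimes>\<^bsub>Q\<^esub> \<phi> b)"


section \<open>Cochains with values in \<open>U(1)\<close>\<close>

definition U1 :: "complex topology" where
  "U1 = top_of_set (sphere 0 1)"

definition cochain0 :: "('o, 'a) groupoid \<Rightarrow> ('o \<Rightarrow> complex) set" where
  "cochain0 \<G> = {f. continuous_map (obj_top \<G>) U1 f}"

definition cochain1 :: "('o, 'a) groupoid \<Rightarrow> ('a \<Rightarrow> complex) set" where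
  "cochain1 \<G> = {f. continuous_map (arr_top \<G>) U1 f \<and> (\<forall>x \<in> objs \<G>. f (ident \<G> x) = 1)}"

definition cochain2 :: "('o, 'a) groupoid \<Rightarrow> ('a \<times> 'a \<Rightarrow> complex) set" where
  "cochain2 \<G> = {f. continuous_map (composable2 \<G>) U1 f \<and>
     (\<forall>a \<in> arrows \<G>. f (ident \<G> (rng \<G> a), a) = 1 \<and> f (a, ident \<G> (src \<G> a)) = 1)}"

definition delta0 :: "('o, 'a) groupoid \<Rightarrow> ('o \<Rightarrow> complex) \<Rightarrow> 'a \<Rightarrow> complex" where
  "delta0 \<G> f = (\<lambda>a. f (src \<G> a) * inverse (f (rng \<G> a)))"

definition delta1 :: "('o, 'a) groupoid \<Rightarrow> ('a \<Rightarrow> complex) \<Rightarrow> 'a \<times> 'a \<Rightarrow> complex" where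
  "delta1 \<G> f = (\<lambda>(a, b). f b * inverse (f (gmult \<G> a b)) * f a)"

definition delta2 :: "('o, 'a) groupoid \<Rightarrow> ('a \<times> 'a \<Rightarrow> complex) \<Rightarrow> 'a \<times> 'a \<times> 'a \<Rightarrow> complex" where
  "delta2 \<G> f = (\<lambda>(a, b, c).
     f (b, c) * inverse (f (gmult \<G> a b, c)) * f (a, gmult \<G> b c) * inverse (f (a, b)))"

definition cocycles2 :: "('o, 'a) groupoid \<Rightarrow> ('a \<times> 'a \<Rightarrow> complex) set" where
  "cocycles2 \<G> = {f \<in> cochain2 \<G>. \<forall>z \<in> topspace (composable3 \<G>). delta2 \<G> f z = 1}"

text \<open>
  The differential of group cochains of \<open>G\<close> with coefficients in the \<open>U(1)\<close>-valued functions on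
  a set with left \<open>G\<close>-action \<open>act\<close>, on which \<open>G\<close> acts by \<open>(g \<cdot> f) x = f (g\<inverse> x)\<close>.
\<close>

definition gd0 ::
  "('g, 'm) monoid_scheme \<Rightarrow> ('g \<Rightarrow> 'x \<Rightarrow> 'x) \<Rightarrow> ('x \<Rightarrow> complex) \<Rightarrow> 'g \<times> 'x \<Rightarrow> complex" where
  "gd0 G act f = (\<lambda>(g, x). f (act (inv\<^bsub>G\<^esub> g) x) * inverse (f x))"

definition gd1 ::
  "('g, 'm) monoid_scheme \<Rightarrow> ('g \<Rightarrow> 'x \<Rightarrow> 'x) \<Rightarrow> ('g \<times> 'x \<Rightarrow> complex) \<Rightarrow>
    'g \<times> 'g \<times> 'x \<Rightarrow> complex" where
  "gd1 G act f = (\<lambda>(g1, g2, x).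
     f (g2, act (inv\<^bsub>G\<^esub> g1) x) * inverse (f (g1 \<otimes>\<^bsub>G\<^esub> g2, x)) * f (g1, x))"

definition gd2 ::
  "('g, 'm) monoid_scheme \<Rightarrow> ('g \<Rightarrow> 'x \<Rightarrow> 'x) \<Rightarrow> ('g \<times> 'g \<times> 'x \<Rightarrow> complex) \<Rightarrow>
    'g \<times> 'g \<times> 'g \<times> 'x \<Rightarrow> complex" where
  "gd2 G act f = (\<lambda>(g1, g2, g3, x).
     f (g2, g3, act (inv\<^bsub>G\<^esub> g1) x) * inverse (f (g1 \<otimes>\<^bsub>G\<^esub> g2, g3, x)) *
     f (g1, g2 \<otimes>\<^bsub>G\<^esub> g3, x) * inverse (f (g1, g2, x)))"

text \<open>
  The sets \<open>C\<^sup>1(G; C\<^sup>1(\<M>; U(1)))\<close> and \<open>C\<^sup>2(G; C\<^sup>0(\<M>; U(1)))\<close>.  Group cochains are normalised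
  like groupoid cochains: they are trivial when an entry is the identity of \<open>G\<close>.
\<close>

definition group_cochain1_1 ::
  "'g top_group \<Rightarrow> ('o, 'a) groupoid \<Rightarrow> ('g \<times> 'a \<Rightarrow> complex) set" where
  "group_cochain1_1 G \<M> = {f. continuous_map (prod_topology (grp_top G) (arr_top \<M>)) U1 f \<and>
     (\<forall>g \<in> carrier G. (\<lambda>h. f (g, h)) \<in> cochain1 \<M>) \<and>
     (\<forall>h \<in> arrows \<M>. f (\<one>\<^bsub>G\<^esub>, h) = 1)}"

definition group_cochain2_0 ::
  "'g top_group \<Rightarrow> ('o, 'a) groupoid \<Rightarrow> ('g \<times> 'g \<times> 'o \<Rightarrow> complex) set" where
  "group_cochain2_0 G \<M> =
     {f. continuous_map (prod_topology (grp_top G) (prod_topology (grp_top G) (obj_top \<M>))) U1 f \<and>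
     (\<forall>g1 \<in> carrier G. \<forall>g2 \<in> carrier G. (\<lambda>x. f (g1, g2, x)) \<in> cochain0 \<M>) \<and>
     (\<forall>g \<in> carrier G. \<forall>x \<in> objs \<M>. f (\<one>\<^bsub>G\<^esub>, g, x) = 1 \<and> f (g, \<one>\<^bsub>G\<^esub>, x) = 1)}"

text \<open>
  \<open>Z\<^sup>2\<^sub>G(\<M>; U(1))\<close> for a groupoid \<open>\<M>\<close> with \<open>G\<close>-action \<open>acto\<close> on objects and \<open>acta\<close> on arrows.
\<close>

definition equivariant_cocycles2 ::
  "'g top_group \<Rightarrow> ('o, 'a) groupoid \<Rightarrow> ('g \<Rightarrow> 'o \<Rightarrow> 'o) \<Rightarrow> ('g \<Rightarrow> 'a \<Rightarrow> 'a) \<Rightarrow>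
    (('a \<times> 'a \<Rightarrow> complex) \<times> ('g \<times> 'a \<Rightarrow> complex) \<times> ('g \<times> 'g \<times> 'o \<Rightarrow> complex)) set" where
  "equivariant_cocycles2 G \<M> acto acta = {(\<sigma>, \<Lambda>, \<beta>).
     \<sigma> \<in> cochain2 \<M> \<and> \<Lambda> \<in> group_cochain1_1 G \<M> \<and> \<beta> \<in> group_cochain2_0 G \<M> \<and>
     (\<forall>z \<in> topspace (composable3 \<M>). delta2 \<M> \<sigma> z = 1) \<and>
     (\<forall>g \<in> carrier G. \<forall>(h1, h2) \<in> topspace (composable2 \<M>).
        gd0 G (\<lambda>g (h1, h2). (acta g h1, acta g h2)) \<sigma> (g, h1, h2) =
        delta1 \<M> (\<lambda>h. \<Lambda> (g, h)) (h1, h2)) \<and>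
     (\<forall>g1 \<in> carrier G. \<forall>g2 \<in> carrier G. \<forall>h \<in> arrows \<M>.
        delta0 \<M> (\<lambda>x. \<beta> (g1, g2, x)) h * gd1 G acta \<Lambda> (g1, g2, h) = 1) \<and>
     (\<forall>g1 \<in> carrier G. \<forall>g2 \<in> carrier G. \<forall>g3 \<in> carrier G. \<forall>x \<in> objs \<M>.
        gd2 G acto \<beta> (g1, g2, g3, x) = 1)}"


section \<open>The groupoids of the theorem\<close>

text \<open>\<open>G/N \<rtimes> \<G>\<close> for a homomorphism \<open>\<rho>bar\<close> to \<open>G/N\<close>, and left translation by \<open>G\<close>.\<close>

definition coset_groupoid ::
  "'g top_group \<Rightarrow> 'g set \<Rightarrow> ('o, 'a) groupoid \<Rightarrow> ('a \<Rightarrow> 'g set) \<Rightarrow>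
    ('g set \<times> 'o, 'g set \<times> 'a) groupoid" where
  "coset_groupoid G N \<G> \<rho>bar =
     \<lparr>obj_top = prod_topology (coset_top G N) (obj_top \<G>),
      arr_top = prod_topology (coset_top G N) (arr_top \<G>),
      src = (\<lambda>(t, \<gamma>). (t \<otimes>\<^bsub>G Mod N\<^esub> \<rho>bar \<gamma>, src \<G> \<gamma>)),
      rng = (\<lambda>(t, \<gamma>). (t, rng \<G> \<gamma>)),
      ident = (\<lambda>(t, x). (t, ident \<G> x)),
      ginv = (\<lambda>(t, \<gamma>). (t \<otimes>\<^bsub>G Mod N\<^esub> \<rho>bar \<gamma>, ginv \<G> \<gamma>)),
      gmult = (\<lambda>(t1, \<gamma>1) (t2, \<gamma>2). (t1, gmult \<G> \<gamma>1 \<gamma>2))\<rparr>"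

definition translate :: "'g top_group \<Rightarrow> 'g \<Rightarrow> 'g set \<times> 'x \<Rightarrow> 'g set \<times> 'x" where
  "translate G g = (\<lambda>(t, x). (g <#\<^bsub>G\<^esub> t, x))"

text \<open>\<open>G \<ltimes> (G/N \<rtimes> \<G>)\<close>; here \<open>\<rho>\<close> is a lift of the homomorphism to \<open>G/N\<close>.\<close>

definition crossed_groupoid ::
  "'g top_group \<Rightarrow> 'g set \<Rightarrow> ('o, 'a) groupoid \<Rightarrow> ('a \<Rightarrow> 'g) \<Rightarrow>
    ('g set \<times> 'o, 'g \<times> 'g set \<times> 'a) groupoid" where
  "crossed_groupoid G N \<G> \<rho> =
     \<lparr>obj_top = prod_topology (coset_top G N) (obj_top \<G>),
      arr_top = prod_topology (grp_top G) (prod_topology (coset_top G N) (arr_top \<G>)),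
      src = (\<lambda>(g, t, \<gamma>). ((inv\<^bsub>G\<^esub> g <#\<^bsub>G\<^esub> t) #>\<^bsub>G\<^esub> \<rho> \<gamma>, src \<G> \<gamma>)),
      rng = (\<lambda>(g, t, \<gamma>). (t, rng \<G> \<gamma>)),
      ident = (\<lambda>(t, x). (\<one>\<^bsub>G\<^esub>, t, ident \<G> x)),
      ginv = (\<lambda>(g, t, \<gamma>). (inv\<^bsub>G\<^esub> g, (inv\<^bsub>G\<^esub> g <#\<^bsub>G\<^esub> t) #>\<^bsub>G\<^esub> \<rho> \<gamma>, ginv \<G> \<gamma>)),
      gmult = (\<lambda>(g1, t1, \<gamma>1) (g2, t2, \<gamma>2). (g1 \<otimes>\<^bsub>G\<^esub> g2, t1, gmult \<G> \<gamma>1 \<gamma>2))\<rparr>"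

definition delta_rho ::
  "'g top_group \<Rightarrow> ('o, 'a) groupoid \<Rightarrow> ('a \<Rightarrow> 'g) \<Rightarrow> 'a \<Rightarrow> 'a \<Rightarrow> 'g" where
  "delta_rho G \<G> \<rho> \<gamma>1 \<gamma>2 = \<rho> \<gamma>1 \<otimes>\<^bsub>G\<^esub> \<rho> \<gamma>2 \<otimes>\<^bsub>G\<^esub> inv\<^bsub>G\<^esub> (\<rho> (gmult \<G> \<gamma>1 \<gamma>2))"

text \<open>
  \<open>N \<rtimes> \<G>\<close> twisted by \<open>\<delta>\<rho>\<close>.  The lift \<open>\<rho>\<close> need not send units of \<open>\<G>\<close> to the identity, so the unit
  over \<open>x\<close> for the twisted product is \<open>(\<rho>(1\<^sub>x)\<inverse>, 1\<^sub>x)\<close>.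
\<close>

definition twisted_product_groupoid ::
  "'g top_group \<Rightarrow> 'g set \<Rightarrow> ('o, 'a) groupoid \<Rightarrow> ('a \<Rightarrow> 'g) \<Rightarrow> ('o, 'g \<times> 'a) groupoid" where
  "twisted_product_groupoid G N \<G> \<rho> =
     \<lparr>obj_top = obj_top \<G>,
      arr_top = prod_topology (subtopology (grp_top G) N) (arr_top \<G>),
      src = (\<lambda>(n, \<gamma>). src \<G> \<gamma>),
      rng = (\<lambda>(n, \<gamma>). rng \<G> \<gamma>),
      ident = (\<lambda>x. (inv\<^bsub>G\<^esub> (\<rho> (ident \<G> x)), ident \<G> x)),
      ginv = (\<lambda>(n, \<gamma>).
        (inv\<^bsub>G\<^esub> (\<rho> \<gamma>) \<otimes>\<^bsub>G\<^esub> inv\<^bsub>G\<^esub> n \<otimes>\<^bsub>G\<^esub> inv\<^bsub>G\<^esub> (\<rho> (ginv \<G> \<gamma>)), ginv \<G> \<gamma>)),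
      gmult = (\<lambda>(n1, \<gamma>1) (n2, \<gamma>2).
        (n1 \<otimes>\<^bsub>G\<^esub> \<rho> \<gamma>1 \<otimes>\<^bsub>G\<^esub> n2 \<otimes>\<^bsub>G\<^esub> inv\<^bsub>G\<^esub> (\<rho> \<gamma>1) \<otimes>\<^bsub>G\<^esub> delta_rho G \<G> \<rho> \<gamma>1 \<gamma>2,
         gmult \<G> \<gamma>1 \<gamma>2))\<rparr>"

text \<open>
  The second \<open>G/N\<close>-entry of a composable pair is determined by the first arrow, so \<open>psi\<close> ignores it.
\<close>

definition psi ::
  "'g top_group \<Rightarrow> ('o, 'a) groupoid \<Rightarrow> ('a \<Rightarrow> 'g) \<Rightarrow>
    (('g set \<times> 'a) \<times> ('g set \<times> 'a) \<Rightarrow> complex) \<Rightarrow> ('g \<times> 'g set \<times> 'a \<Rightarrow> complex) \<Rightarrow>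
    ('g \<times> 'g \<times> 'g set \<times> 'o \<Rightarrow> complex) \<Rightarrow>
    ('g \<times> 'g set \<times> 'a) \<times> ('g \<times> 'g set \<times> 'a) \<Rightarrow> complex" where
  "psi G \<G> \<rho> \<sigma> \<Lambda> \<beta> = (\<lambda>((g1, t, \<gamma>1), (g2, _, \<gamma>2)).
     \<sigma> ((t, \<gamma>1), (t #>\<^bsub>G\<^esub> \<rho> \<gamma>1, \<gamma>2)) *
     \<Lambda> (g1, t #>\<^bsub>G\<^esub> \<rho> \<gamma>1, \<gamma>2) *
     \<beta> (g1, g2, (t #>\<^bsub>G\<^esub> \<rho> \<gamma>1) #>\<^bsub>G\<^esub> \<rho> \<gamma>2, src \<G> \<gamma>2))"

definition chi ::
  "'g top_group \<Rightarrow> 'g set \<Rightarrow> ('o, 'a) groupoid \<Rightarrow> ('a \<Rightarrow> 'g) \<Rightarrow>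
    (('g set \<times> 'a) \<times> ('g set \<times> 'a) \<Rightarrow> complex) \<Rightarrow> ('g \<times> 'g set \<times> 'a \<Rightarrow> complex) \<Rightarrow>
    ('g \<times> 'g \<times> 'g set \<times> 'o \<Rightarrow> complex) \<Rightarrow>
    ('g \<times> 'a) \<times> ('g \<times> 'a) \<Rightarrow> complex" where
  "chi G N \<G> \<rho> \<sigma> \<Lambda> \<beta> = (\<lambda>((n1, \<gamma>1), (n2, \<gamma>2)).
     \<sigma> ((\<one>\<^bsub>G Mod N\<^esub>, \<gamma>1), (N #>\<^bsub>G\<^esub> \<rho> \<gamma>1, \<gamma>2)) *
     \<Lambda> (n1 \<otimes>\<^bsub>G\<^esub> \<rho> \<gamma>1, N #>\<^bsub>G\<^esub> \<rho> \<gamma>1, \<gamma>2) *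
     \<beta> (n1 \<otimes>\<^bsub>G\<^esub> \<rho> \<gamma>1, n2 \<otimes>\<^bsub>G\<^esub> \<rho> \<gamma>2, N #>\<^bsub>G\<^esub> (\<rho> \<gamma>1 \<otimes>\<^bsub>G\<^esub> \<rho> \<gamma>2), src \<G> \<gamma>2))"


section \<open>Morita equivalence of twisted groupoids\<close>

record ('p, 'ho, 'h, 'ko, 'k) bimodule =
  bim_top :: "'p topology"
  lmom :: "'p \<Rightarrow> 'ho"
  rmom :: "'p \<Rightarrow> 'ko"
  lact :: "'h \<Rightarrow> 'p \<Rightarrow> 'p"
  ract :: "'p \<Rightarrow> 'k \<Rightarrow> 'p"

definition left_fibre_product ::
  "('o, 'a) groupoid \<Rightarrow> 'p topology \<Rightarrow> ('p \<Rightarrow> 'o) \<Rightarrow> ('a \<times> 'p) topology" where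
  "left_fibre_product \<H> X m = subtopology (prod_topology (arr_top \<H>) X) {(h, p). src \<H> h = m p}"

definition right_fibre_product ::
  "('o, 'a) groupoid \<Rightarrow> 'p topology \<Rightarrow> ('p \<Rightarrow> 'o) \<Rightarrow> ('p \<times> 'a) topology" where
  "right_fibre_product \<K> X m = subtopology (prod_topology X (arr_top \<K>)) {(p, k). m p = rng \<K> k}"

definition left_action ::
  "('o, 'a) groupoid \<Rightarrow> 'p topology \<Rightarrow> ('p \<Rightarrow> 'o) \<Rightarrow> ('a \<Rightarrow> 'p \<Rightarrow> 'p) \<Rightarrow> bool" where
  "left_action \<H> X m act \<longleftrightarrow>
     continuous_map X (obj_top \<H>) m \<and>
     continuous_map (left_fibre_product \<H> X m) X (\<lambda>(h, p). act h p) \<and>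
     (\<forall>(h, p) \<in> topspace (left_fibre_product \<H> X m). m (act h p) = rng \<H> h) \<and>
     (\<forall>p \<in> topspace X. act (ident \<H> (m p)) p = p) \<and>
     (\<forall>(h1, h2) \<in> topspace (composable2 \<H>). \<forall>p \<in> topspace X. src \<H> h2 = m p \<longrightarrow>
        act (gmult \<H> h1 h2) p = act h1 (act h2 p))"

definition right_action ::
  "('o, 'a) groupoid \<Rightarrow> 'p topology \<Rightarrow> ('p \<Rightarrow> 'o) \<Rightarrow> ('p \<Rightarrow> 'a \<Rightarrow> 'p) \<Rightarrow> bool" where
  "right_action \<K> X m act \<longleftrightarrow>
     continuous_map X (obj_top \<K>) m \<and>
     continuous_map (right_fibre_product \<K> X m) X (\<lambda>(p, k). act p k) \<and>
     (\<forall>(p, k) \<in> topspace (right_fibre_product \<K> X m). m (act p k) = src \<K> k) \<and>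
     (\<forall>p \<in> topspace X. act p (ident \<K> (m p)) = p) \<and>
     (\<forall>(k1, k2) \<in> topspace (composable2 \<K>). \<forall>p \<in> topspace X. m p = rng \<K> k1 \<longrightarrow>
        act p (gmult \<K> k1 k2) = act (act p k1) k2)"

definition left_free ::
  "('o, 'a) groupoid \<Rightarrow> 'p topology \<Rightarrow> ('p \<Rightarrow> 'o) \<Rightarrow> ('a \<Rightarrow> 'p \<Rightarrow> 'p) \<Rightarrow> bool" where
  "left_free \<H> X m act \<longleftrightarrow>
     (\<forall>(h, p) \<in> topspace (left_fibre_product \<H> X m). act h p = p \<longrightarrow> h = ident \<H> (m p))"

definition right_free ::
  "('o, 'a) groupoid \<Rightarrow> 'p topology \<Rightarrow> ('p \<Rightarrow> 'o) \<Rightarrow> ('p \<Rightarrow> 'a \<Rightarrow> 'p) \<Rightarrow> bool" where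
  "right_free \<K> X m act \<longleftrightarrow>
     (\<forall>(p, k) \<in> topspace (right_fibre_product \<K> X m). act p k = p \<longrightarrow> k = ident \<K> (m p))"

definition left_proper ::
  "('o, 'a) groupoid \<Rightarrow> 'p topology \<Rightarrow> ('p \<Rightarrow> 'o) \<Rightarrow> ('a \<Rightarrow> 'p \<Rightarrow> 'p) \<Rightarrow> bool" where
  "left_proper \<H> X m act \<longleftrightarrow>
     proper_map (left_fibre_product \<H> X m) (prod_topology X X) (\<lambda>(h, p). (act h p, p))"

definition right_proper ::
  "('o, 'a) groupoid \<Rightarrow> 'p topology \<Rightarrow> ('p \<Rightarrow> 'o) \<Rightarrow> ('p \<Rightarrow> 'a \<Rightarrow> 'p) \<Rightarrow> bool" where
  "right_proper \<K> X m act \<longleftrightarrow>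
     proper_map (right_fibre_product \<K> X m) (prod_topology X X) (\<lambda>(p, k). (p, act p k))"

definition left_orbit ::
  "('o, 'a) groupoid \<Rightarrow> ('p \<Rightarrow> 'o) \<Rightarrow> ('a \<Rightarrow> 'p \<Rightarrow> 'p) \<Rightarrow> 'p \<Rightarrow> 'p set" where
  "left_orbit \<H> m act p = {act h p | h. h \<in> arrows \<H> \<and> src \<H> h = m p}"

definition right_orbit ::
  "('o, 'a) groupoid \<Rightarrow> ('p \<Rightarrow> 'o) \<Rightarrow> ('p \<Rightarrow> 'a \<Rightarrow> 'p) \<Rightarrow> 'p \<Rightarrow> 'p set" where
  "right_orbit \<K> m act p = {act p k | k. k \<in> arrows \<K> \<and> m p = rng \<K> k}"

definition induces_homeomorphism ::
  "'p topology \<Rightarrow> ('p \<Rightarrow> 'p set) \<Rightarrow> 'o topology \<Rightarrow> ('p \<Rightarrow> 'o) \<Rightarrow> bool" where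
  "induces_homeomorphism X orb Y m \<longleftrightarrow>
     (\<exists>f. homeomorphic_map (quotient_topology X orb) Y f \<and> (\<forall>p \<in> topspace X. f (orb p) = m p))"

definition morita_bimodule ::
  "('ho, 'h) groupoid \<Rightarrow> ('ko, 'k) groupoid \<Rightarrow> ('p, 'ho, 'h, 'ko, 'k) bimodule \<Rightarrow> bool" where
  "morita_bimodule \<H> \<K> P \<longleftrightarrow>
     Hausdorff_space (bim_top P) \<and> locally_compact_space (bim_top P) \<and>
     left_action \<H> (bim_top P) (lmom P) (lact P) \<and>
     left_free \<H> (bim_top P) (lmom P) (lact P) \<and>
     left_proper \<H> (bim_top P) (lmom P) (lact P) \<and>
     right_action \<K> (bim_top P) (rmom P) (ract P) \<and>
     right_free \<K> (bim_top P) (rmom P) (ract P) \<and>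
     right_proper \<K> (bim_top P) (rmom P) (ract P) \<and>
     (\<forall>h \<in> arrows \<H>. \<forall>p \<in> topspace (bim_top P). src \<H> h = lmom P p \<longrightarrow>
        rmom P (lact P h p) = rmom P p) \<and>
     (\<forall>p \<in> topspace (bim_top P). \<forall>k \<in> arrows \<K>. rmom P p = rng \<K> k \<longrightarrow>
        lmom P (ract P p k) = lmom P p) \<and>
     (\<forall>h \<in> arrows \<H>. \<forall>p \<in> topspace (bim_top P). \<forall>k \<in> arrows \<K>.
        src \<H> h = lmom P p \<and> rmom P p = rng \<K> k \<longrightarrow>
        ract P (lact P h p) k = lact P h (ract P p k)) \<and>
     induces_homeomorphism (bim_top P) (right_orbit \<K> (rmom P) (ract P)) (obj_top \<H>) (lmom P) \<and>
     induces_homeomorphism (bim_top P) (left_orbit \<H> (lmom P) (lact P)) (obj_top \<K>) (rmom P)"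

definition cohomologous_on ::
  "('ho, 'h) groupoid \<Rightarrow> ('h \<times> 'h \<Rightarrow> complex) \<Rightarrow> ('ko, 'k) groupoid \<Rightarrow> ('k \<times> 'k \<Rightarrow> complex) \<Rightarrow>
    ('p, 'ho, 'h, 'ko, 'k) bimodule \<Rightarrow> bool" where
  "cohomologous_on \<H> \<psi> \<K> \<omega> P \<longleftrightarrow> (\<exists>\<mu> \<nu>.
     continuous_map (left_fibre_product \<H> (bim_top P) (lmom P)) U1 \<mu> \<and>
     continuous_map (right_fibre_product \<K> (bim_top P) (rmom P)) U1 \<nu> \<and>
     (\<forall>(h1, h2) \<in> topspace (composable2 \<H>). \<forall>p \<in> topspace (bim_top P). src \<H> h2 = lmom P p \<longrightarrow>
        \<mu> (h2, p) * inverse (\<mu> (gmult \<H> h1 h2, p)) * \<mu> (h1, lact P h2 p) = \<psi> (h1, h2)) \<and>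
     (\<forall>(k1, k2) \<in> topspace (composable2 \<K>). \<forall>p \<in> topspace (bim_top P). rmom P p = rng \<K> k1 \<longrightarrow>
        \<nu> (ract P p k1, k2) * inverse (\<nu> (p, gmult \<K> k1 k2)) * \<nu> (p, k1) = \<omega> (k1, k2)) \<and>
     (\<forall>h \<in> arrows \<H>. \<forall>p \<in> topspace (bim_top P). \<forall>k \<in> arrows \<K>.
        src \<H> h = lmom P p \<and> rmom P p = rng \<K> k \<longrightarrow>
        \<mu> (h, p) * \<nu> (lact P h p, k) = \<nu> (p, k) * \<mu> (h, ract P p k)))"

text \<open>
  Second countability and Haar systems play no role in Morita equivalence and are not part of the
  following notion; the crossed groupoid of a group that is not second countable is not second
  countable either.
\<close>

definition twisted_groupoid :: "('o, 'a) groupoid \<Rightarrow> ('a \<times> 'a \<Rightarrow> complex) \<Rightarrow> bool" where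
  "twisted_groupoid \<H> \<psi> \<longleftrightarrow> locally_compact_groupoid \<H> \<and> \<psi> \<in> cocycles2 \<H>"

text \<open>\<open>P\<close> is a Morita equivalence between the twisted groupoids \<open>(\<H>, \<psi>)\<close> and \<open>(\<K>, \<omega>)\<close>.\<close>

definition twisted_morita_equivalence ::
  "('ho, 'h) groupoid \<Rightarrow> ('h \<times> 'h \<Rightarrow> complex) \<Rightarrow> ('ko, 'k) groupoid \<Rightarrow> ('k \<times> 'k \<Rightarrow> complex) \<Rightarrow>
    ('p, 'ho, 'h, 'ko, 'k) bimodule \<Rightarrow> bool" where
  "twisted_morita_equivalence \<H> \<psi> \<K> \<omega> P \<longleftrightarrow>
     twisted_groupoid \<H> \<psi> \<and> twisted_groupoid \<K> \<omega> \<and>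
     morita_bimodule \<H> \<K> P \<and> cohomologous_on \<H> \<psi> \<K> \<omega> P"

end

theory Submission
  imports Defs
begin

text \<open>
Write \<open>\<H>\<close> and \<open>\<K>\<close> for the crossed groupoid \<open>G \<ltimes> (G/N \<rtimes> \<G>)\<close> and the twisted product \<open>N \<rtimes> \<G>\<close>.
Everything follows from one observation: \<open>\<K>\<close> is the full subgroupoid of \<open>\<H>\<close> on the objects
\<open>{N} \<times> \<G>\<^sub>0\<close>.  An arrow \<open>(g, N, \<gamma>)\<close> of \<open>\<H>\<close> starts over \<open>g\<inverse> N \<rho>(\<gamma>)\<close>, so it starts over \<open>N\<close> exactly when
\<open>g = n \<rho>(\<gamma>)\<close> with \<open>n \<in> N\<close>; the map \<open>(n, \<gamma>) \<mapsto> (n \<rho>(\<gamma>), N, \<gamma>)\<close> turns the twisted product of \<open>\<K>\<close>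
into the product of \<open>\<H>\<close>, because \<open>n\<^sub>1 \<rho>\<^sub>1 n\<^sub>2 \<rho>\<^sub>1\<inverse> \<delta>\<rho> \<rho>(\<gamma>\<^sub>1\<gamma>\<^sub>2) = n\<^sub>1 \<rho>\<^sub>1 n\<^sub>2 \<rho>\<^sub>2\<close>, and it pulls \<open>\<psi>\<close> back
to \<open>\<chi>\<close>.

For a full subgroupoid \<open>\<K> = \<H>|\<^sub>Y\<close>, the space \<open>P\<close> of arrows of \<open>\<H>\<close> with source in \<open>Y\<close> carries the
left action of \<open>\<H>\<close> and the right action of \<open>\<K>\<close> by multiplication.  Both actions are free, and both
are proper because the acting arrow is the quotient \<open>p' p\<inverse>\<close>, respectively \<open>p\<inverse> p'\<close>, which depends
continuously on \<open>(p, p')\<close> in a closed subset of \<open>P \<times> P\<close>.  The orbits are the fibres of source and range,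
so \<open>P\<close> is a Morita bimodule as soon as the range map \<open>P \<rightarrow> \<H>\<^sub>0\<close> is a quotient map
(\<open>morita_bimodule_linking\<close>).  A cocycle \<open>\<psi>\<close> on \<open>\<H>\<close> itself provides the cochains that compare it with
its restriction: \<open>\<mu>(h, p) = \<psi>(h, p)\<close> and \<open>\<nu>(p, k) = \<psi>(p, k)\<close>, and the three required identities
are instances of \<open>\<delta>\<psi> = 1\<close> (\<open>cohomologous_on_linking\<close>).

For \<open>Y = {N} \<times> \<G>\<^sub>0\<close> the space \<open>P\<close> is homeomorphic to \<open>G \<times> \<G>\<^sub>1\<close>, via
\<open>(g, \<gamma>) \<mapsto> (g, g \<rho>(\<gamma>)\<inverse> N, \<gamma>)\<close>.  Its range map is a quotient map since \<open>G \<rightarrow> G/N\<close> is one, even after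
multiplication with the locally compact Hausdorff space \<open>\<G>\<^sub>0\<close>, and since the range map of \<open>\<G>\<close> has
the units as a section (\<open>linking_rng_quotient\<close>).  The remaining computation is that \<open>\<psi>\<close> is a cocycle
on \<open>\<H>\<close> (\<open>psi_cocycle\<close>): translating \<open>\<sigma>\<close> by \<open>G\<close> costs \<open>\<delta>\<Lambda>\<close>, the failure of \<open>\<Lambda>\<close> to be multiplicative
in \<open>G\<close> is the inverse of \<open>\<delta>\<beta>\<close>, and \<open>\<beta>\<close> is a cocycle of \<open>G\<close>, so that all corrections cancel.
\<close>


section \<open>Quotients, closed embeddings and proper maps\<close>

lemma Hausdorff_space_open_quotient:
  assumes "continuous_map X Y f" "open_map X Y f" "f ` topspace X = topspace Y"
    and closed: "closedin (prod_topology X X) {(x, y). x \<in> topspace X \<and> y \<in> topspace X \<and> f x = f y}"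
  shows "Hausdorff_space Y"
  unfolding Hausdorff_space_def
proof (intro allI impI)
  fix a b assume ab: "a \<in> topspace Y \<and> b \<in> topspace Y \<and> a \<noteq> b"
  then obtain x y where xy: "x \<in> topspace X" "y \<in> topspace X" "f x = a" "f y = b"
    using assms(3) by (metis imageE)
  let ?R = "{(x, y). x \<in> topspace X \<and> y \<in> topspace X \<and> f x = f y}"
  have op: "openin (prod_topology X X) (topspace X \<times> topspace X - ?R)"
    using openin_diff[OF openin_topspace closed] by (simp only: topspace_prod_topology)
  have "(x, y) \<in> topspace X \<times> topspace X - ?R"
    using xy ab by blast
  with op obtain U V where UV: "openin X U" "openin X V" "x \<in> U" "y \<in> V"
      and sub: "U \<times> V \<subseteq> topspace X \<times> topspace X - ?R"
    by (smt (verit) openin_prod_topology_alt)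
  have "openin Y (f ` U)" "openin Y (f ` V)"
    using UV assms(2) by (auto simp: open_map_def)
  moreover have "disjnt (f ` U) (f ` V)"
    using sub by (auto simp: disjnt_iff)
  ultimately show "\<exists>U V. openin Y U \<and> openin Y V \<and> a \<in> U \<and> b \<in> V \<and> disjnt U V"
    using UV xy by (metis imageI)
qed

text \<open>
Properness of an action will follow from this criterion: a free action whose acting arrow can be
recovered continuously from a point and its translate is a closed embedding.
\<close>

lemma closed_embedding_imp_proper:
  assumes f: "continuous_map X Y f" and C: "closedin Y C"
    and fC: "\<And>x. x \<in> topspace X \<Longrightarrow> f x \<in> C"
    and g: "continuous_map (subtopology Y C) X g"
    and gf: "\<And>x. x \<in> topspace X \<Longrightarrow> g (f x) = x"
    and fg: "\<And>y. y \<in> C \<Longrightarrow> f (g y) = y"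
  shows "proper_map X Y f"
proof -
  have "homeomorphic_maps X (subtopology Y C) f g"
    unfolding homeomorphic_maps_def using f g gf fg fC closedin_subset[OF C]
    by (auto simp: continuous_map_in_subtopology topspace_subtopology)
  then have "closed_map X (subtopology Y C) f"
    by (meson homeomorphic_imp_closed_map homeomorphic_map_maps)
  then have "closed_map X Y f"
    using C closed_map_from_closed_subtopology by blast
  moreover have "inj_on f (topspace X)"
    by (metis gf inj_onI)
  ultimately show ?thesis
    by (rule closed_injective_imp_proper_map)
qed

text \<open>
Two quotient maps with the same fibres factor through each other.
\<close>

lemma induces_homeomorphismI:
  assumes m: "quotient_map X Y m"
    and fib: "\<And>p q. \<lbrakk>p \<in> topspace X; q \<in> topspace X\<rbrakk> \<Longrightarrow> orb p = orb q \<longleftrightarrow> m p = m q"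
  shows "induces_homeomorphism X orb Y m"
proof -
  let ?Q = "quotient_topology X orb"
  have q: "quotient_map X ?Q orb"
    by (rule quotient_map_quotient_topology)
  obtain f where f: "continuous_map ?Q Y f" "\<And>x. x \<in> topspace X \<Longrightarrow> f (orb x) = m x"
    using quotient_map_lift_exists[OF q quotient_imp_continuous_map[OF m]] fib by metis
  obtain g where g: "continuous_map Y ?Q g" "\<And>x. x \<in> topspace X \<Longrightarrow> g (m x) = orb x"
    using quotient_map_lift_exists[OF m quotient_imp_continuous_map[OF q]] fib by metis
  have "homeomorphic_maps ?Q Y f g"
    unfolding homeomorphic_maps_def using f g quotient_imp_surjective_map[OF m]
    by (auto simp: topspace_quotient_topology image_iff) (metis f(2) g(2) image_iff)
  then show ?thesis
    unfolding induces_homeomorphism_def using f(2) homeomorphic_map_maps by blast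
qed

lemma quotient_map_section:
  assumes "continuous_map X Y f" "continuous_map Y X s" "\<And>y. y \<in> topspace Y \<Longrightarrow> f (s y) = y"
  shows "quotient_map X Y f"
  using assms by (intro retraction_imp_quotient_map) (auto simp: retraction_map_def retraction_maps_def)

section \<open>The quotient of a locally compact group by a closed normal subgroup\<close>

locale closed_normal_subgroup = locally_compact_group G + normal N G
  for G :: "'g top_group" (structure) and N +
  assumes closed: "closedin (grp_top G) N"
begin

abbreviation "TG \<equiv> grp_top G"
abbreviation "TQ \<equiv> coset_top G N"
abbreviation "proj \<equiv> \<lambda>g. N #> g"

lemma topspace_coset_top: "topspace TQ = rcosets N"
  by (auto simp: coset_top_def topspace_quotient_topology topspace_grp RCOSETS_def)

lemma coset_topE:
  assumes "t \<in> topspace TQ"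
  obtains a where "a \<in> carrier G" "t = N #> a"
  using assms by (auto simp: topspace_coset_top RCOSETS_def)

lemma proj_in [simp]: "a \<in> carrier G \<Longrightarrow> N #> a \<in> topspace TQ"
  by (auto simp: topspace_coset_top RCOSETS_def)

lemma N_in [simp]: "N \<in> topspace TQ"
  using proj_in[of "\<one>"] by (simp add: coset_mult_one subset)

lemma proj_eq_iff:
  assumes "a \<in> carrier G" "b \<in> carrier G"
  shows "N #> a = N #> b \<longleftrightarrow> a \<otimes> inv b \<in> N"
proof
  assume "N #> a = N #> b"
  then have "a \<in> N #> b" using assms by (metis rcos_self is_subgroup)
  then show "a \<otimes> inv b \<in> N"
    using assms by (auto simp: r_coset_def m_assoc)
next
  assume "a \<otimes> inv b \<in> N"
  then have "a \<in> N #> b"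
    using assms by (auto simp: r_coset_def m_assoc intro!: bexI[of _ "a \<otimes> inv b"])
  then show "N #> a = N #> b"
    using assms repr_independence is_subgroup by metis
qed

lemma proj_mult_left:
  assumes "g \<in> carrier G" "a \<in> carrier G"
  shows "g <#\<^bsub>G\<^esub> (N #> a) = N #> (g \<otimes> a)"
proof -
  have "g <#\<^bsub>G\<^esub> (N #> a) = (g <#\<^bsub>G\<^esub> N) #> a"
    using assms by (metis coset_assoc subset)
  also have "\<dots> = (N #> g) #> a"
    using assms coset_eq by auto
  finally show ?thesis using assms by (simp add: coset_mult_assoc subset)
qed

lemma proj_mult_right:
  "\<lbrakk>a \<in> carrier G; b \<in> carrier G\<rbrakk> \<Longrightarrow> (N #> a) #> b = N #> (a \<otimes> b)"
  by (simp add: coset_mult_assoc subset)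

lemma proj_quotient: "quotient_map TG TQ proj"
  unfolding coset_top_def by (rule quotient_map_quotient_topology)

lemma proj_continuous: "continuous_map TG TQ proj"
  by (rule quotient_imp_continuous_map[OF proj_quotient])

lemma continuous_map_mult:
  "\<lbrakk>continuous_map X TG f; continuous_map X TG g\<rbrakk> \<Longrightarrow> continuous_map X TG (\<lambda>x. f x \<otimes> g x)"
  using continuous_map_compose[OF continuous_map_pairedI mult_continuous] by (simp add: o_def)

lemma continuous_map_inv:
  "continuous_map X TG f \<Longrightarrow> continuous_map X TG (\<lambda>x. inv (f x))"
  using continuous_map_compose[OF _ inv_continuous] by (simp add: o_def)

lemma continuous_map_proj:
  "continuous_map X TG f \<Longrightarrow> continuous_map X TQ (\<lambda>x. N #> f x)"
  using continuous_map_compose[OF _ proj_continuous] by (simp add: o_def)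

text \<open>
The saturation of an open set \<open>U\<close> is the union of its translates \<open>n\<inverse> U\<close> with \<open>n \<in> N\<close>.
\<close>

lemma proj_open: "open_map TG TQ proj"
  unfolding open_map_def
proof (intro allI impI)
  fix U assume U: "openin TG U"
  then have UG: "U \<subseteq> carrier G" using openin_subset topspace_grp by blast
  have "{x \<in> topspace TG. N #> x \<in> proj ` U} = (\<Union>n\<in>N. {x \<in> topspace TG. n \<otimes> x \<in> U})"
  proof (intro equalityI subsetI)
    fix x assume "x \<in> {x \<in> topspace TG. N #> x \<in> proj ` U}"
    then obtain u where u: "x \<in> carrier G" "u \<in> U" "N #> u = N #> x"
      by (auto simp: topspace_grp)
    then have "u \<otimes> inv x \<in> N" using UG proj_eq_iff by blast
    moreover have "u \<otimes> inv x \<otimes> x = u" using u UG by (simp add: m_assoc subset_iff)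
    ultimately show "x \<in> (\<Union>n\<in>N. {x \<in> topspace TG. n \<otimes> x \<in> U})"
      using u by (force simp: topspace_grp)
  next
    fix x assume "x \<in> (\<Union>n\<in>N. {x \<in> topspace TG. n \<otimes> x \<in> U})"
    then obtain n where n: "n \<in> N" "x \<in> carrier G" "n \<otimes> x \<in> U" by (auto simp: topspace_grp)
    then have "N #> (n \<otimes> x) = N #> x"
      by (simp add: proj_eq_iff m_assoc)
    then show "x \<in> {x \<in> topspace TG. N #> x \<in> proj ` U}"
      using n by (auto simp: topspace_grp intro!: image_eqI[of _ _ "n \<otimes> x"])
  qed
  moreover have "openin TG {x \<in> topspace TG. n \<otimes> x \<in> U}" if "n \<in> N" for n
    using that by (intro openin_continuous_map_preimage[OF _ U] continuous_map_mult)
      (auto simp: topspace_grp)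
  ultimately have "openin TG {x \<in> topspace TG. N #> x \<in> proj ` U}"
    by (auto intro: openin_Union)
  then show "openin TQ (proj ` U)"
    using UG by (auto simp: coset_top_def openin_quotient_topology topspace_grp)
qed

lemma Hausdorff_coset_top: "Hausdorff_space TQ"
proof (rule Hausdorff_space_open_quotient[OF proj_continuous proj_open])
  show "proj ` topspace TG = topspace TQ"
    using proj_quotient quotient_imp_surjective_map by blast
  have "closedin (prod_topology TG TG) {z \<in> topspace (prod_topology TG TG). fst z \<otimes> inv (snd z) \<in> N}"
    by (intro closedin_continuous_map_preimage[OF _ closed] continuous_map_mult continuous_map_inv
        continuous_map_fst continuous_map_snd)
  also have "{z \<in> topspace (prod_topology TG TG). fst z \<otimes> inv (snd z) \<in> N} =
      {(x, y). x \<in> topspace TG \<and> y \<in> topspace TG \<and> N #> x = N #> y}"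
  proof (rule Set.set_eqI)
    show "z \<in> {z \<in> topspace (prod_topology TG TG). fst z \<otimes> inv (snd z) \<in> N} \<longleftrightarrow>
      z \<in> {(x, y). x \<in> topspace TG \<and> y \<in> topspace TG \<and> N #> x = N #> y}" for z
      by (cases z) (simp add: topspace_grp proj_eq_iff cong: conj_cong)
  qed
  finally show "closedin (prod_topology TG TG) {(x, y). x \<in> topspace TG \<and> y \<in> topspace TG \<and> N #> x = N #> y}" .
qed

lemma locally_compact_coset_top: "locally_compact_space TQ"
  using locally_compact_space_continuous_open_map_image[OF proj_continuous proj_open _ locally_compact_grp]
    quotient_imp_surjective_map[OF proj_quotient] by blast

text \<open>
Continuity of the two translations is tested on \<open>G \<times> G\<close>: multiplying the quotient map \<open>G \<rightarrow> G/N\<close>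
with the locally compact Hausdorff space \<open>G\<close> gives a quotient map again.
\<close>

lemma left_translation_continuous:
  "continuous_map (prod_topology TG TQ) TQ (\<lambda>(g, t). g <#\<^bsub>G\<^esub> t)"
proof (rule continuous_compose_quotient_map)
  show "quotient_map (prod_topology TG TG) (prod_topology TG TQ) (\<lambda>(x, y). (x, N #> y))"
    using quotient_map_prod_right[OF locally_compact_grp _ proj_quotient] Hausdorff_grp by blast
  have "continuous_map (prod_topology TG TG) TQ (\<lambda>z. N #> (fst z \<otimes> snd z))"
    by (intro continuous_map_proj continuous_map_mult continuous_map_fst continuous_map_snd)
  then show "continuous_map (prod_topology TG TG) TQ ((\<lambda>(g, t). g <#\<^bsub>G\<^esub> t) \<circ> (\<lambda>(x, y). (x, N #> y)))"
    by (rule continuous_map_eq) (auto simp: topspace_grp proj_mult_left)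
qed

lemma right_translation_continuous:
  "continuous_map (prod_topology TQ TG) TQ (\<lambda>(t, g). t #> g)"
proof (rule continuous_compose_quotient_map)
  show "quotient_map (prod_topology TG TG) (prod_topology TQ TG) (\<lambda>(x, y). (N #> x, y))"
    using quotient_map_prod_left[OF locally_compact_grp _ proj_quotient] Hausdorff_grp by blast
  have "continuous_map (prod_topology TG TG) TQ (\<lambda>z. N #> (fst z \<otimes> snd z))"
    by (intro continuous_map_proj continuous_map_mult continuous_map_fst continuous_map_snd)
  then show "continuous_map (prod_topology TG TG) TQ ((\<lambda>(t, g). t #> g) \<circ> (\<lambda>(x, y). (N #> x, y)))"
    by (rule continuous_map_eq) (auto simp: topspace_grp proj_mult_right)
qed

lemma continuous_map_left_translation:
  "\<lbrakk>continuous_map X TG f; continuous_map X TQ g\<rbrakk> \<Longrightarrow> continuous_map X TQ (\<lambda>x. f x <#\<^bsub>G\<^esub> g x)"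
  using continuous_map_compose[OF continuous_map_pairedI left_translation_continuous] by (simp add: o_def)

lemma continuous_map_right_translation:
  "\<lbrakk>continuous_map X TQ f; continuous_map X TG g\<rbrakk> \<Longrightarrow> continuous_map X TQ (\<lambda>x. f x #> g x)"
  using continuous_map_compose[OF continuous_map_pairedI right_translation_continuous] by (simp add: o_def)

end

section \<open>Calculus in topological groupoids\<close>

context topological_groupoid
begin

lemma in_composable2 [simp]:
  "(a, b) \<in> topspace (composable2 \<G>) \<longleftrightarrow> a \<in> arrows \<G> \<and> b \<in> arrows \<G> \<and> src \<G> a = rng \<G> b"
  by (auto simp: composable2_def)

lemma in_composable3 [simp]:
  "(a, b, c) \<in> topspace (composable3 \<G>) \<longleftrightarrow> a \<in> arrows \<G> \<and> b \<in> arrows \<G> \<and> c \<in> arrows \<G> \<and>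
    src \<G> a = rng \<G> b \<and> src \<G> b = rng \<G> c"
  by (auto simp: composable3_def)

lemma src_in [simp]: "a \<in> arrows \<G> \<Longrightarrow> src \<G> a \<in> objs \<G>"
  and rng_in [simp]: "a \<in> arrows \<G> \<Longrightarrow> rng \<G> a \<in> objs \<G>"
  and ident_in [simp]: "x \<in> objs \<G> \<Longrightarrow> ident \<G> x \<in> arrows \<G>"
  and ginv_in [simp]: "a \<in> arrows \<G> \<Longrightarrow> ginv \<G> a \<in> arrows \<G>"
  using src_continuous rng_continuous ident_continuous ginv_continuous
  by (auto simp: continuous_map_def)

lemma gmult_in [simp]:
  "\<lbrakk>a \<in> arrows \<G>; b \<in> arrows \<G>; src \<G> a = rng \<G> b\<rbrakk> \<Longrightarrow> gmult \<G> a b \<in> arrows \<G>"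
  using funcset_mem[OF continuous_map_funspace[OF gmult_continuous], of "(a, b)"] by simp

lemma src_mult [simp]:
  "\<lbrakk>a \<in> arrows \<G>; b \<in> arrows \<G>; src \<G> a = rng \<G> b\<rbrakk> \<Longrightarrow> src \<G> (gmult \<G> a b) = src \<G> b"
  and rng_mult [simp]:
  "\<lbrakk>a \<in> arrows \<G>; b \<in> arrows \<G>; src \<G> a = rng \<G> b\<rbrakk> \<Longrightarrow> rng \<G> (gmult \<G> a b) = rng \<G> a"
  using src_gmult rng_gmult by auto

lemma mult_assoc:
  "\<lbrakk>a \<in> arrows \<G>; b \<in> arrows \<G>; c \<in> arrows \<G>; src \<G> a = rng \<G> b; src \<G> b = rng \<G> c\<rbrakk> \<Longrightarrow>
    gmult \<G> (gmult \<G> a b) c = gmult \<G> a (gmult \<G> b c)"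
  using gmult_assoc by simp

lemma ginv_cancel_left:
  "\<lbrakk>a \<in> arrows \<G>; b \<in> arrows \<G>; rng \<G> a = rng \<G> b\<rbrakk> \<Longrightarrow> gmult \<G> a (gmult \<G> (ginv \<G> a) b) = b"
  by (simp add: mult_assoc[symmetric] src_ginv rng_ginv ginv_right ident_left)

lemma ginv_cancel_left':
  "\<lbrakk>a \<in> arrows \<G>; b \<in> arrows \<G>; src \<G> a = rng \<G> b\<rbrakk> \<Longrightarrow> gmult \<G> (ginv \<G> a) (gmult \<G> a b) = b"
  by (simp add: mult_assoc[symmetric] src_ginv rng_ginv ginv_left ident_left)

lemma ginv_cancel_right:
  "\<lbrakk>a \<in> arrows \<G>; b \<in> arrows \<G>; src \<G> a = src \<G> b\<rbrakk> \<Longrightarrow> gmult \<G> (gmult \<G> a (ginv \<G> b)) b = a"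
  by (simp add: mult_assoc src_ginv rng_ginv ginv_left) (metis ident_right)

lemma ginv_cancel_right':
  "\<lbrakk>a \<in> arrows \<G>; b \<in> arrows \<G>; src \<G> a = rng \<G> b\<rbrakk> \<Longrightarrow> gmult \<G> (gmult \<G> a b) (ginv \<G> b) = a"
  by (simp add: mult_assoc src_ginv rng_ginv ginv_right) (metis ident_right)

lemma continuous_map_gmult:
  assumes "continuous_map X (arr_top \<G>) f" "continuous_map X (arr_top \<G>) g"
    and "\<And>x. x \<in> topspace X \<Longrightarrow> src \<G> (f x) = rng \<G> (g x)"
  shows "continuous_map X (arr_top \<G>) (\<lambda>x. gmult \<G> (f x) (g x))"
proof -
  have "continuous_map X (composable2 \<G>) (\<lambda>x. (f x, g x))"
    unfolding composable2_def using assms by (auto simp: continuous_map_in_subtopology continuous_map_paired)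
  from continuous_map_compose[OF this gmult_continuous] show ?thesis
    by (simp add: o_def)
qed

lemma continuous_map_src: "continuous_map X (arr_top \<G>) f \<Longrightarrow> continuous_map X (obj_top \<G>) (\<lambda>x. src \<G> (f x))"
  and continuous_map_rng: "continuous_map X (arr_top \<G>) f \<Longrightarrow> continuous_map X (obj_top \<G>) (\<lambda>x. rng \<G> (f x))"
  and continuous_map_ginv: "continuous_map X (arr_top \<G>) f \<Longrightarrow> continuous_map X (arr_top \<G>) (\<lambda>x. ginv \<G> (f x))"
  and continuous_map_ident: "continuous_map X (obj_top \<G>) g \<Longrightarrow> continuous_map X (arr_top \<G>) (\<lambda>x. ident \<G> (g x))"
  using continuous_map_compose[OF _ src_continuous] continuous_map_compose[OF _ rng_continuous]
    continuous_map_compose[OF _ ginv_continuous] continuous_map_compose[OF _ ident_continuous]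
  by (auto simp: o_def)

lemma continuous_map_cochain2:
  assumes "\<psi> \<in> cochain2 \<G>" "continuous_map X (arr_top \<G>) f" "continuous_map X (arr_top \<G>) g"
    and "\<And>x. x \<in> topspace X \<Longrightarrow> src \<G> (f x) = rng \<G> (g x)"
  shows "continuous_map X U1 (\<lambda>x. \<psi> (f x, g x))"
proof -
  have "continuous_map X (composable2 \<G>) (\<lambda>x. (f x, g x))"
    unfolding composable2_def using assms by (auto simp: continuous_map_in_subtopology continuous_map_paired)
  from continuous_map_compose[OF this] show ?thesis
    using assms(1) by (auto simp: cochain2_def o_def)
qed

lemma cochain2_nonzero:
  assumes "\<psi> \<in> cochain2 \<G>" "a \<in> arrows \<G>" "b \<in> arrows \<G>" "src \<G> a = rng \<G> b"
  shows "\<psi> (a, b) \<noteq> 0"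
proof -
  have "\<psi> (a, b) \<in> topspace U1"
    using assms continuous_map_funspace[of "composable2 \<G>" U1 \<psi>] in_composable2[of a b]
    by (auto simp: cochain2_def)
  then show ?thesis by (auto simp: U1_def)
qed

lemma cocycle2_eq:
  assumes "\<psi> \<in> cocycles2 \<G>" "a \<in> arrows \<G>" "b \<in> arrows \<G>" "c \<in> arrows \<G>"
    "src \<G> a = rng \<G> b" "src \<G> b = rng \<G> c"
  shows "\<psi> (b, c) * \<psi> (a, gmult \<G> b c) = \<psi> (gmult \<G> a b, c) * \<psi> (a, b)"
proof -
  have c: "\<psi> \<in> cochain2 \<G>" using assms(1) by (simp add: cocycles2_def)
  have "delta2 \<G> \<psi> (a, b, c) = 1"
    using assms by (auto simp: cocycles2_def)
  moreover have "\<psi> (gmult \<G> a b, c) \<noteq> 0" "\<psi> (a, b) \<noteq> 0"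
    using assms cochain2_nonzero[OF c] by simp_all
  ultimately show ?thesis
    by (simp add: delta2_def field_simps)
qed

lemma Hausdorff_objs:
  assumes "Hausdorff_space (arr_top \<G>)"
  shows "Hausdorff_space (obj_top \<G>)"
  using Hausdorff_space_injective_preimage[OF assms ident_continuous] 
  by (metis inj_onI src_ident)

text \<open>
The units embed the objects as a retract of the arrows.
\<close>

lemma locally_compact_objs:
  assumes "locally_compact_space (arr_top \<G>)" "Hausdorff_space (arr_top \<G>)"
  shows "locally_compact_space (obj_top \<G>)"
proof (rule locally_compact_space_retraction_map_image)
  show "retraction_map (arr_top \<G>) (obj_top \<G>) (rng \<G>)"
    using rng_continuous ident_continuous rng_ident
    by (auto simp: retraction_map_def retraction_maps_def)
qed (use assms in auto)

end

section \<open>Full subgroupoids\<close>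

text \<open>
\<open>\<K>\<close> is a copy, on other types, of the full subgroupoid of \<open>\<H>\<close> on the objects \<open>\<iota>(\<K>\<^sub>0)\<close>: \<open>\<phi>\<close> is the inclusion
of arrows, and \<open>\<kappa>\<close> and \<open>\<theta>\<close> are continuous inverses of \<open>\<iota>\<close> and \<open>\<phi>\<close> on their images.  The structure of
\<open>\<K>\<close> is prescribed through \<open>\<theta>\<close>, so that the groupoid laws of \<open>\<K>\<close> become consequences of those of
\<open>\<H>\<close>.
\<close>

locale full_subgroupoid = H: topological_groupoid \<H>
  for \<H> :: "('ho, 'h) groupoid" +
  fixes \<K> :: "('ko, 'k) groupoid"
    and \<iota> :: "'ko \<Rightarrow> 'ho" and \<kappa> :: "'ho \<Rightarrow> 'ko"
    and \<phi> :: "'k \<Rightarrow> 'h" and \<theta> :: "'h \<Rightarrow> 'k"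
  assumes \<iota>_continuous: "continuous_map (obj_top \<K>) (obj_top \<H>) \<iota>"
    and \<kappa>_continuous: "continuous_map (subtopology (obj_top \<H>) (\<iota> ` objs \<K>)) (obj_top \<K>) \<kappa>"
    and \<kappa>_\<iota>: "x \<in> objs \<K> \<Longrightarrow> \<kappa> (\<iota> x) = x"
    and \<phi>_continuous: "continuous_map (arr_top \<K>) (arr_top \<H>) \<phi>"
    and \<theta>_continuous: "continuous_map
      (subtopology (arr_top \<H>) {h. src \<H> h \<in> \<iota> ` objs \<K> \<and> rng \<H> h \<in> \<iota> ` objs \<K>}) (arr_top \<K>) \<theta>"
    and \<theta>_\<phi>: "k \<in> arrows \<K> \<Longrightarrow> \<theta> (\<phi> k) = k"
    and \<phi>_\<theta>: "\<lbrakk>h \<in> arrows \<H>; src \<H> h \<in> \<iota> ` objs \<K>; rng \<H> h \<in> \<iota> ` objs \<K>\<rbrakk> \<Longrightarrow> \<phi> (\<theta> h) = h"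
    and src_K: "k \<in> arrows \<K> \<Longrightarrow> src \<K> k \<in> objs \<K>"
    and rng_K: "k \<in> arrows \<K> \<Longrightarrow> rng \<K> k \<in> objs \<K>"
    and src_\<phi>: "k \<in> arrows \<K> \<Longrightarrow> src \<H> (\<phi> k) = \<iota> (src \<K> k)"
    and rng_\<phi>: "k \<in> arrows \<K> \<Longrightarrow> rng \<H> (\<phi> k) = \<iota> (rng \<K> k)"
    and ident_K: "x \<in> objs \<K> \<Longrightarrow> ident \<K> x = \<theta> (ident \<H> (\<iota> x))"
    and ginv_K: "k \<in> arrows \<K> \<Longrightarrow> ginv \<K> k = \<theta> (ginv \<H> (\<phi> k))"
    and gmult_K: "\<lbrakk>k \<in> arrows \<K>; l \<in> arrows \<K>; src \<K> k = rng \<K> l\<rbrakk> \<Longrightarrow>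
      gmult \<K> k l = \<theta> (gmult \<H> (\<phi> k) (\<phi> l))"
begin

lemma \<iota>_in [simp]: "x \<in> objs \<K> \<Longrightarrow> \<iota> x \<in> objs \<H>"
  using \<iota>_continuous by (auto simp: continuous_map_def)

lemma \<phi>_in [simp]: "k \<in> arrows \<K> \<Longrightarrow> \<phi> k \<in> arrows \<H>"
  using \<phi>_continuous by (auto simp: continuous_map_def)

lemma \<theta>_in:
  "\<lbrakk>h \<in> arrows \<H>; src \<H> h \<in> \<iota> ` objs \<K>; rng \<H> h \<in> \<iota> ` objs \<K>\<rbrakk> \<Longrightarrow> \<theta> h \<in> arrows \<K>"
  using continuous_map_funspace[OF \<theta>_continuous] by auto

lemma continuous_map_\<kappa>:
  "\<lbrakk>continuous_map X (obj_top \<H>) f; \<And>x. x \<in> topspace X \<Longrightarrow> f x \<in> \<iota> ` objs \<K>\<rbrakk> \<Longrightarrow>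
    continuous_map X (obj_top \<K>) (\<lambda>x. \<kappa> (f x))"
  using continuous_map_compose[OF _ \<kappa>_continuous, of X f]
  by (auto simp: continuous_map_in_subtopology o_def)

lemma continuous_map_\<theta>:
  "\<lbrakk>continuous_map X (arr_top \<H>) f; \<And>x. x \<in> topspace X \<Longrightarrow> src \<H> (f x) \<in> \<iota> ` objs \<K>;
    \<And>x. x \<in> topspace X \<Longrightarrow> rng \<H> (f x) \<in> \<iota> ` objs \<K>\<rbrakk> \<Longrightarrow>
    continuous_map X (arr_top \<K>) (\<lambda>x. \<theta> (f x))"
  using continuous_map_compose[OF _ \<theta>_continuous, of X f]
  by (auto simp: continuous_map_in_subtopology o_def)

lemma continuous_map_\<phi>:
  "continuous_map X (arr_top \<K>) f \<Longrightarrow> continuous_map X (arr_top \<H>) (\<lambda>x. \<phi> (f x))"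
  using continuous_map_compose[OF _ \<phi>_continuous, of X f] by (auto simp: o_def)

lemma \<phi>_ident: "x \<in> objs \<K> \<Longrightarrow> \<phi> (ident \<K> x) = ident \<H> (\<iota> x)"
  by (simp add: ident_K \<phi>_\<theta> H.src_ident H.rng_ident)

lemma \<phi>_ginv: "k \<in> arrows \<K> \<Longrightarrow> \<phi> (ginv \<K> k) = ginv \<H> (\<phi> k)"
  by (simp add: ginv_K \<phi>_\<theta> H.src_ginv H.rng_ginv src_\<phi> rng_\<phi> src_K rng_K)

lemma \<phi>_gmult:
  "\<lbrakk>k \<in> arrows \<K>; l \<in> arrows \<K>; src \<K> k = rng \<K> l\<rbrakk> \<Longrightarrow> \<phi> (gmult \<K> k l) = gmult \<H> (\<phi> k) (\<phi> l)"
  by (simp add: gmult_K \<phi>_\<theta> src_\<phi> rng_\<phi> src_K rng_K)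

lemma \<phi>_eq_iff: "\<lbrakk>k \<in> arrows \<K>; l \<in> arrows \<K>\<rbrakk> \<Longrightarrow> \<phi> k = \<phi> l \<longleftrightarrow> k = l"
  by (metis \<theta>_\<phi>)

lemma ident_K_in: "x \<in> objs \<K> \<Longrightarrow> ident \<K> x \<in> arrows \<K>"
  by (simp add: ident_K \<theta>_in H.src_ident H.rng_ident)

lemma ginv_K_in: "k \<in> arrows \<K> \<Longrightarrow> ginv \<K> k \<in> arrows \<K>"
  by (simp add: ginv_K \<theta>_in H.src_ginv H.rng_ginv src_\<phi> rng_\<phi> src_K rng_K)

lemma gmult_K_in:
  "\<lbrakk>k \<in> arrows \<K>; l \<in> arrows \<K>; src \<K> k = rng \<K> l\<rbrakk> \<Longrightarrow> gmult \<K> k l \<in> arrows \<K>"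
  by (simp add: gmult_K \<theta>_in src_\<phi> rng_\<phi> src_K rng_K)

lemma src_K_eq: "k \<in> arrows \<K> \<Longrightarrow> src \<K> k = \<kappa> (src \<H> (\<phi> k))"
  and rng_K_eq: "k \<in> arrows \<K> \<Longrightarrow> rng \<K> k = \<kappa> (rng \<H> (\<phi> k))"
  by (simp_all add: src_\<phi> rng_\<phi> \<kappa>_\<iota> src_K rng_K)

lemma src_gmult_K:
  assumes "k \<in> arrows \<K>" "l \<in> arrows \<K>" "src \<K> k = rng \<K> l"
  shows "src \<K> (gmult \<K> k l) = src \<K> l"
proof -
  have "src \<H> (\<phi> (gmult \<K> k l)) = src \<H> (\<phi> l)"
    using assms by (simp add: \<phi>_gmult src_\<phi> rng_\<phi>)
  then show ?thesis
    using assms by (simp add: src_K_eq gmult_K_in)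
qed

lemma rng_gmult_K:
  assumes "k \<in> arrows \<K>" "l \<in> arrows \<K>" "src \<K> k = rng \<K> l"
  shows "rng \<K> (gmult \<K> k l) = rng \<K> k"
proof -
  have "rng \<H> (\<phi> (gmult \<K> k l)) = rng \<H> (\<phi> k)"
    using assms by (simp add: \<phi>_gmult src_\<phi> rng_\<phi>)
  then show ?thesis
    using assms by (simp add: rng_K_eq gmult_K_in)
qed

text \<open>
Continuity is transported along \<open>\<theta>\<close> and \<open>\<kappa>\<close>; each algebraic law is checked after applying the
injective map \<open>\<phi>\<close>.
\<close>

lemma topological_groupoid_K: "topological_groupoid \<K>"
proof
  show "continuous_map (arr_top \<K>) (obj_top \<K>) (src \<K>)"
    using continuous_map_eq[OF continuous_map_\<kappa>[OF H.continuous_map_src[OF \<phi>_continuous]]]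
    by (simp add: src_\<phi> src_K \<kappa>_\<iota>)
  show "continuous_map (arr_top \<K>) (obj_top \<K>) (rng \<K>)"
    using continuous_map_eq[OF continuous_map_\<kappa>[OF H.continuous_map_rng[OF \<phi>_continuous]]]
    by (simp add: rng_\<phi> rng_K \<kappa>_\<iota>)
  show "continuous_map (obj_top \<K>) (arr_top \<K>) (ident \<K>)"
    using continuous_map_eq[OF continuous_map_\<theta>[OF H.continuous_map_ident[OF \<iota>_continuous]]]
    by (simp add: ident_K H.src_ident H.rng_ident)
  show "continuous_map (arr_top \<K>) (arr_top \<K>) (ginv \<K>)"
    using continuous_map_eq[OF continuous_map_\<theta>[OF H.continuous_map_ginv[OF \<phi>_continuous]]]
    by (simp add: ginv_K H.src_ginv H.rng_ginv src_\<phi> rng_\<phi> src_K rng_K)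
  have comp: "continuous_map (composable2 \<K>) (arr_top \<H>) (\<lambda>z. \<phi> (fst z))"
    "continuous_map (composable2 \<K>) (arr_top \<H>) (\<lambda>z. \<phi> (snd z))"
    by (auto simp: composable2_def intro!: continuous_map_\<phi> continuous_map_from_subtopology
        continuous_map_fst continuous_map_snd)
  have c2: "(a, b) \<in> topspace (composable2 \<K>) \<longleftrightarrow> a \<in> arrows \<K> \<and> b \<in> arrows \<K> \<and> src \<K> a = rng \<K> b" for a b
    by (auto simp: composable2_def)
  have c3: "(a, b, c) \<in> topspace (composable3 \<K>) \<longleftrightarrow> a \<in> arrows \<K> \<and> b \<in> arrows \<K> \<and> c \<in> arrows \<K> \<and>
    src \<K> a = rng \<K> b \<and> src \<K> b = rng \<K> c" for a b c
    by (auto simp: composable3_def)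
  have m: "continuous_map (composable2 \<K>) (arr_top \<H>) (\<lambda>z. gmult \<H> (\<phi> (fst z)) (\<phi> (snd z)))"
    by (intro H.continuous_map_gmult comp) (auto simp: c2 src_\<phi> rng_\<phi>)
  show "continuous_map (composable2 \<K>) (arr_top \<K>) (\<lambda>(a, b). gmult \<K> a b)"
    by (rule continuous_map_eq[OF continuous_map_\<theta>[OF m]])
      (auto simp: c2 gmult_K src_\<phi> rng_\<phi> src_K rng_K)
  show "src \<K> (ident \<K> x) = x" "rng \<K> (ident \<K> x) = x" if "x \<in> objs \<K>" for x
    using that by (simp_all add: src_K_eq rng_K_eq ident_K_in \<phi>_ident H.src_ident H.rng_ident \<kappa>_\<iota>)
  show "src \<K> (gmult \<K> a b) = src \<K> b" "rng \<K> (gmult \<K> a b) = rng \<K> a"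
    if "(a, b) \<in> topspace (composable2 \<K>)" for a b
    using that by (simp_all add: c2 src_gmult_K rng_gmult_K)
  show "gmult \<K> (gmult \<K> a b) c = gmult \<K> a (gmult \<K> b c)"
    if "(a, b, c) \<in> topspace (composable3 \<K>)" for a b c
  proof -
    have "\<phi> (gmult \<K> (gmult \<K> a b) c) = \<phi> (gmult \<K> a (gmult \<K> b c))"
      using that by (simp add: c3 \<phi>_gmult gmult_K_in src_gmult_K rng_gmult_K H.mult_assoc src_\<phi> rng_\<phi>)
    then show ?thesis
      using that by (simp add: c3 \<phi>_eq_iff gmult_K_in src_gmult_K rng_gmult_K)
  qed
  fix a assume a: "a \<in> arrows \<K>"
  have si: "src \<K> (ident \<K> x) = x" "rng \<K> (ident \<K> x) = x" if "x \<in> objs \<K>" for x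
    using that by (simp_all add: src_K_eq rng_K_eq ident_K_in \<phi>_ident H.src_ident H.rng_ident \<kappa>_\<iota>)
  show s: "src \<K> (ginv \<K> a) = rng \<K> a" "rng \<K> (ginv \<K> a) = src \<K> a"
    using a by (simp_all add: src_K_eq rng_K_eq ginv_K_in \<phi>_ginv H.src_ginv H.rng_ginv)
  have "\<phi> (gmult \<K> (ident \<K> (rng \<K> a)) a) = \<phi> a"
    using a by (simp add: \<phi>_gmult ident_K_in rng_K si \<phi>_ident H.ident_left flip: rng_\<phi>)
  then show "gmult \<K> (ident \<K> (rng \<K> a)) a = a"
    using a by (simp add: \<phi>_eq_iff gmult_K_in ident_K_in rng_K si)
  have "\<phi> (gmult \<K> a (ident \<K> (src \<K> a))) = \<phi> a"
    using a by (simp add: \<phi>_gmult ident_K_in src_K si \<phi>_ident H.ident_right flip: src_\<phi>)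
  then show "gmult \<K> a (ident \<K> (src \<K> a)) = a"
    using a by (simp add: \<phi>_eq_iff gmult_K_in ident_K_in src_K si)
  have "\<phi> (gmult \<K> (ginv \<K> a) a) = \<phi> (ident \<K> (src \<K> a))"
    using a s by (simp add: \<phi>_gmult ginv_K_in \<phi>_ginv \<phi>_ident src_K H.ginv_left src_\<phi>)
  then show "gmult \<K> (ginv \<K> a) a = ident \<K> (src \<K> a)"
    using a s by (simp add: \<phi>_eq_iff gmult_K_in ident_K_in ginv_K_in src_K)
  have "\<phi> (gmult \<K> a (ginv \<K> a)) = \<phi> (ident \<K> (rng \<K> a))"
    using a s by (simp add: \<phi>_gmult ginv_K_in \<phi>_ginv \<phi>_ident rng_K H.ginv_right rng_\<phi>)
  then show "gmult \<K> a (ginv \<K> a) = ident \<K> (rng \<K> a)"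
    using a s by (simp add: \<phi>_eq_iff gmult_K_in ident_K_in ginv_K_in rng_K)
qed

sublocale K: topological_groupoid \<K>
  by (rule topological_groupoid_K)

lemma cocycle_restrict:
  assumes \<psi>: "\<psi> \<in> cocycles2 \<H>"
    and eq: "\<And>k l. \<lbrakk>k \<in> arrows \<K>; l \<in> arrows \<K>; src \<K> k = rng \<K> l\<rbrakk> \<Longrightarrow> \<omega> (k, l) = \<psi> (\<phi> k, \<phi> l)"
  shows "\<omega> \<in> cocycles2 \<K>"
proof -
  have c: "\<psi> \<in> cochain2 \<H>" using \<psi> unfolding cocycles2_def by blast
  have comp: "continuous_map (composable2 \<K>) (arr_top \<H>) (\<lambda>z. \<phi> (fst z))"
    "continuous_map (composable2 \<K>) (arr_top \<H>) (\<lambda>z. \<phi> (snd z))"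
    by (auto simp: composable2_def intro!: continuous_map_\<phi> continuous_map_from_subtopology
        continuous_map_fst continuous_map_snd)
  have "continuous_map (composable2 \<K>) U1 (\<lambda>z. \<psi> (\<phi> (fst z), \<phi> (snd z)))"
    by (rule H.continuous_map_cochain2[OF c comp]) (auto simp: src_\<phi> rng_\<phi>)
  then have "continuous_map (composable2 \<K>) U1 \<omega>"
    by (rule continuous_map_eq) (auto simp: eq)
  moreover have "\<omega> (ident \<K> (rng \<K> a), a) = 1 \<and> \<omega> (a, ident \<K> (src \<K> a)) = 1" if "a \<in> arrows \<K>" for a
    using that c by (simp add: eq K.src_ident K.rng_ident \<phi>_ident cochain2_def) (metis \<phi>_in rng_\<phi> src_\<phi>)
  ultimately have "\<omega> \<in> cochain2 \<K>" by (simp add: cochain2_def)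
  moreover have "delta2 \<K> \<omega> (a, b, d) = 1" if "(a, b, d) \<in> topspace (composable3 \<K>)" for a b d
  proof -
    have "delta2 \<K> \<omega> (a, b, d) = delta2 \<H> \<psi> (\<phi> a, \<phi> b, \<phi> d)"
      using that by (simp add: delta2_def eq \<phi>_gmult)
    also have "\<dots> = 1"
      using that \<psi> by (auto simp: cocycles2_def src_\<phi> rng_\<phi>)
    finally show ?thesis .
  qed
  ultimately show ?thesis by (auto simp: cocycles2_def)
qed

end

section \<open>The linking bimodule of a full subgroupoid\<close>

text \<open>
\<open>X\<close> is a model for the space of arrows of \<open>\<H>\<close> whose source belongs to the subgroupoid: \<open>J\<close> embeds it
into \<open>\<H>\<close>, with the continuous inverse \<open>L\<close>.  That the range map is a quotient map says
both that the subgroupoid meets every orbit of \<open>\<H>\<close> and that \<open>X/\<K>\<close> has the topology of \<open>\<H>\<^sub>0\<close>.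
\<close>

locale full_subgroupoid_bimodule = full_subgroupoid +
  fixes X :: "'p topology" and J :: "'p \<Rightarrow> 'b" and L :: "'b \<Rightarrow> 'p"
  assumes J_continuous: "continuous_map X (arr_top \<H>) J"
    and src_J: "p \<in> topspace X \<Longrightarrow> src \<H> (J p) \<in> \<iota> ` objs \<K>"
    and L_continuous:
      "continuous_map (subtopology (arr_top \<H>) {h. src \<H> h \<in> \<iota> ` objs \<K>}) X L"
    and L_J: "p \<in> topspace X \<Longrightarrow> L (J p) = p"
    and J_L: "\<lbrakk>h \<in> arrows \<H>; src \<H> h \<in> \<iota> ` objs \<K>\<rbrakk> \<Longrightarrow> J (L h) = h"
    and rng_J_quotient: "quotient_map X (obj_top \<H>) (\<lambda>p. rng \<H> (J p))"
    and Hausdorff_objs_H: "Hausdorff_space (obj_top \<H>)"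
    and Hausdorff_X: "Hausdorff_space X"
    and locally_compact_X: "locally_compact_space X"
begin

definition linking_bimodule :: "('p, 'a, 'b, 'c, 'd) bimodule" where
  "linking_bimodule = \<lparr>bim_top = X,
     lmom = (\<lambda>p. rng \<H> (J p)),
     rmom = (\<lambda>p. \<kappa> (src \<H> (J p))),
     lact = (\<lambda>h p. L (gmult \<H> h (J p))),
     ract = (\<lambda>p k. L (gmult \<H> (J p) (\<phi> k)))\<rparr>"

lemma J_in [simp]: "p \<in> topspace X \<Longrightarrow> J p \<in> arrows \<H>"
  using continuous_map_funspace[OF J_continuous] by auto

lemma L_in: "\<lbrakk>h \<in> arrows \<H>; src \<H> h \<in> \<iota> ` objs \<K>\<rbrakk> \<Longrightarrow> L h \<in> topspace X"
  using continuous_map_funspace[OF L_continuous] by auto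

lemma \<iota>_\<kappa>_src: "p \<in> topspace X \<Longrightarrow> \<iota> (\<kappa> (src \<H> (J p))) = src \<H> (J p)"
  using src_J \<kappa>_\<iota> by fastforce

lemma \<kappa>_src_in: "p \<in> topspace X \<Longrightarrow> \<kappa> (src \<H> (J p)) \<in> objs \<K>"
  using src_J \<kappa>_\<iota> by fastforce

lemma rmom_eq_iff:
  assumes "p \<in> topspace X" "x \<in> objs \<K>"
  shows "\<kappa> (src \<H> (J p)) = x \<longleftrightarrow> src \<H> (J p) = \<iota> x"
  using \<iota>_\<kappa>_src[OF assms(1)] \<kappa>_\<iota>[OF assms(2)] by metis

lemma rmom_eq_rng_iff:
  assumes "p \<in> topspace X" "k \<in> arrows \<K>"
  shows "\<kappa> (src \<H> (J p)) = rng \<K> k \<longleftrightarrow> src \<H> (J p) = rng \<H> (\<phi> k)"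
  using rmom_eq_iff[of p "rng \<K> k"] assms by (simp add: rng_\<phi>)

lemma continuous_map_L:
  "\<lbrakk>continuous_map Z (arr_top \<H>) f; \<And>z. z \<in> topspace Z \<Longrightarrow> src \<H> (f z) \<in> \<iota> ` objs \<K>\<rbrakk> \<Longrightarrow>
    continuous_map Z X (\<lambda>z. L (f z))"
  using continuous_map_compose[OF _ L_continuous, of Z f]
  by (auto simp: continuous_map_in_subtopology o_def)

lemma continuous_map_J: "continuous_map Z X f \<Longrightarrow> continuous_map Z (arr_top \<H>) (\<lambda>z. J (f z))"
  using continuous_map_compose[OF _ J_continuous, of Z f] by (simp add: o_def)

lemma left_mult:
  assumes "h \<in> arrows \<H>" "p \<in> topspace X" "src \<H> h = rng \<H> (J p)"
  shows "J (L (gmult \<H> h (J p))) = gmult \<H> h (J p)" "L (gmult \<H> h (J p)) \<in> topspace X"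
  using assms src_J by (auto intro!: J_L L_in)

lemma right_mult:
  assumes "p \<in> topspace X" "k \<in> arrows \<K>" "src \<H> (J p) = rng \<H> (\<phi> k)"
  shows "J (L (gmult \<H> (J p) (\<phi> k))) = gmult \<H> (J p) (\<phi> k)" "L (gmult \<H> (J p) (\<phi> k)) \<in> topspace X"
  using assms by (auto intro!: J_L L_in simp: src_\<phi>)

lemma left_action_linking:
  "left_action \<H> X (\<lambda>p. rng \<H> (J p)) (\<lambda>h p. L (gmult \<H> h (J p)))"
proof -
  let ?F = "left_fibre_product \<H> X (\<lambda>p. rng \<H> (J p))"
  have F: "continuous_map ?F (arr_top \<H>) fst" "continuous_map ?F X snd"
    by (auto simp: left_fibre_product_def intro!: continuous_map_from_subtopology
        continuous_map_fst continuous_map_snd)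
  have "continuous_map ?F X (\<lambda>z. L (gmult \<H> (fst z) (J (snd z))))"
    by (intro continuous_map_L H.continuous_map_gmult continuous_map_J F)
      (auto simp: left_fibre_product_def src_J)
  then have "continuous_map ?F X (\<lambda>(h, p). L (gmult \<H> h (J p)))"
    by (simp add: case_prod_unfold)
  moreover have "continuous_map X (obj_top \<H>) (\<lambda>p. rng \<H> (J p))"
    by (intro H.continuous_map_rng J_continuous)
  moreover have "rng \<H> (J (L (gmult \<H> h (J p)))) = rng \<H> h" if "(h, p) \<in> topspace ?F" for h p
    using that by (simp add: left_fibre_product_def left_mult)
  moreover have "L (gmult \<H> (ident \<H> (rng \<H> (J p))) (J p)) = p" if "p \<in> topspace X" for p
    using that by (simp add: H.ident_left L_J)
  moreover have "L (gmult \<H> (gmult \<H> h1 h2) (J p)) = L (gmult \<H> h1 (J (L (gmult \<H> h2 (J p)))))"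
    if "(h1, h2) \<in> topspace (composable2 \<H>)" "p \<in> topspace X" "src \<H> h2 = rng \<H> (J p)" for h1 h2 p
    using that by (simp add: left_mult H.mult_assoc)
  ultimately show ?thesis
    unfolding left_action_def by blast
qed

lemma right_action_linking:
  "right_action \<K> X (\<lambda>p. \<kappa> (src \<H> (J p))) (\<lambda>p k. L (gmult \<H> (J p) (\<phi> k)))"
proof -
  let ?F = "right_fibre_product \<K> X (\<lambda>p. \<kappa> (src \<H> (J p)))"
  have F: "continuous_map ?F X fst" "continuous_map ?F (arr_top \<K>) snd"
    by (auto simp: right_fibre_product_def intro!: continuous_map_from_subtopology
        continuous_map_fst continuous_map_snd)
  have "continuous_map ?F X (\<lambda>z. L (gmult \<H> (J (fst z)) (\<phi> (snd z))))"
    by (intro continuous_map_L H.continuous_map_gmult continuous_map_J continuous_map_\<phi> F)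
      (auto simp: right_fibre_product_def rmom_eq_rng_iff src_\<phi>)
  then have "continuous_map ?F X (\<lambda>(p, k). L (gmult \<H> (J p) (\<phi> k)))"
    by (simp add: case_prod_unfold)
  moreover have "continuous_map X (obj_top \<K>) (\<lambda>p. \<kappa> (src \<H> (J p)))"
    by (intro continuous_map_\<kappa> H.continuous_map_src J_continuous src_J)
  moreover have "\<kappa> (src \<H> (J (L (gmult \<H> (J p) (\<phi> k))))) = src \<K> k" if "(p, k) \<in> topspace ?F" for p k
    using that rmom_eq_rng_iff[of p k]
    by (simp add: right_fibre_product_def right_mult src_\<phi> \<kappa>_\<iota> src_K)
  moreover have "L (gmult \<H> (J p) (\<phi> (ident \<K> (\<kappa> (src \<H> (J p)))))) = p" if "p \<in> topspace X" for p
    using that by (simp add: \<phi>_ident \<kappa>_src_in \<iota>_\<kappa>_src H.ident_right L_J)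
  moreover have "L (gmult \<H> (J p) (\<phi> (gmult \<K> k1 k2))) =
      L (gmult \<H> (J (L (gmult \<H> (J p) (\<phi> k1)))) (\<phi> k2))"
    if "(k1, k2) \<in> topspace (composable2 \<K>)" "p \<in> topspace X" "\<kappa> (src \<H> (J p)) = rng \<K> k1" for k1 k2 p
    using that rmom_eq_rng_iff[of p k1] by (simp add: right_mult \<phi>_gmult H.mult_assoc src_\<phi> rng_\<phi>)
  ultimately show ?thesis
    unfolding right_action_def by blast
qed

lemma left_free_linking:
  "left_free \<H> X (\<lambda>p. rng \<H> (J p)) (\<lambda>h p. L (gmult \<H> h (J p)))"
proof -
  have "h = ident \<H> (rng \<H> (J p))"
    if "h \<in> arrows \<H>" "p \<in> topspace X" "src \<H> h = rng \<H> (J p)" "L (gmult \<H> h (J p)) = p" for h p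
  proof -
    have "gmult \<H> h (J p) = J p"
      using left_mult(1) that by metis
    then have "h = gmult \<H> (J p) (ginv \<H> (J p))"
      using H.ginv_cancel_right'[of h "J p"] that by simp
    then show ?thesis
      using that by (simp add: H.ginv_right)
  qed
  then show ?thesis
    unfolding left_free_def by (auto simp: left_fibre_product_def)
qed

lemma right_free_linking:
  "right_free \<K> X (\<lambda>p. \<kappa> (src \<H> (J p))) (\<lambda>p k. L (gmult \<H> (J p) (\<phi> k)))"
proof -
  have "k = ident \<K> (\<kappa> (src \<H> (J p)))"
    if "k \<in> arrows \<K>" "p \<in> topspace X" "\<kappa> (src \<H> (J p)) = rng \<K> k" "L (gmult \<H> (J p) (\<phi> k)) = p" for k p
  proof -
    have e: "src \<H> (J p) = rng \<H> (\<phi> k)" using that rmom_eq_rng_iff by blast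
    then have "gmult \<H> (J p) (\<phi> k) = J p"
      using right_mult(1) that by metis
    then have "\<phi> k = gmult \<H> (ginv \<H> (J p)) (J p)"
      using H.ginv_cancel_left'[of "J p" "\<phi> k"] that e by simp
    also have "\<dots> = ident \<H> (\<iota> (rng \<K> k))"
      using that e by (simp add: H.ginv_left rng_\<phi>)
    finally have "\<phi> k = \<phi> (ident \<K> (rng \<K> k))"
      using that by (simp add: \<phi>_ident)
    then show ?thesis
      using that by (simp add: \<phi>_eq_iff)
  qed
  then show ?thesis
    unfolding right_free_def by (auto simp: right_fibre_product_def)
qed

text \<open>
A pair \<open>(p', p)\<close> is of the form \<open>(h p, p)\<close> exactly when both have the same source, a closed condition,
and then \<open>h = p' p\<inverse>\<close>.
\<close>

lemma left_proper_linking: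
  "left_proper \<H> X (\<lambda>p. rng \<H> (J p)) (\<lambda>h p. L (gmult \<H> h (J p)))"
  unfolding left_proper_def
proof (rule closed_embedding_imp_proper)
  let ?F = "left_fibre_product \<H> X (\<lambda>p. rng \<H> (J p))"
  let ?C = "{z \<in> topspace (prod_topology X X). src \<H> (J (fst z)) = src \<H> (J (snd z))}"
  let ?g = "\<lambda>z. (gmult \<H> (J (fst z)) (ginv \<H> (J (snd z))), snd z)"
  have "continuous_map ?F X (\<lambda>z. (case z of (h, p) \<Rightarrow> L (gmult \<H> h (J p))))"
    using left_action_linking unfolding left_action_def by auto
  moreover have "continuous_map ?F X snd"
    by (auto simp: left_fibre_product_def intro!: continuous_map_from_subtopology continuous_map_snd)
  ultimately show "continuous_map ?F (prod_topology X X) (\<lambda>(h, p). (L (gmult \<H> h (J p)), p))"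
    by (simp add: continuous_map_paired case_prod_unfold)
  show "closedin (prod_topology X X) ?C"
    by (intro closedin_continuous_maps_eq[OF Hausdorff_objs_H] H.continuous_map_src continuous_map_J
        continuous_map_fst continuous_map_snd)
  show "(case z of (h, p) \<Rightarrow> (L (gmult \<H> h (J p)), p)) \<in> ?C" if "z \<in> topspace ?F" for z
    using that by (auto simp: left_fibre_product_def left_mult)
  show "?g (case z of (h, p) \<Rightarrow> (L (gmult \<H> h (J p)), p)) = z" if "z \<in> topspace ?F" for z
    using that by (auto simp: left_fibre_product_def left_mult H.ginv_cancel_right')
  show "(case ?g z of (h, p) \<Rightarrow> (L (gmult \<H> h (J p)), p)) = z" if "z \<in> ?C" for z
    using that by (auto simp: H.ginv_cancel_right L_J)
  let ?CT = "subtopology (prod_topology X X) ?C"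
  have "continuous_map ?CT X fst" "continuous_map ?CT X snd"
    by (auto intro!: continuous_map_from_subtopology continuous_map_fst continuous_map_snd)
  then have "continuous_map ?CT (prod_topology (arr_top \<H>) X) ?g"
    by (intro continuous_map_pairedI H.continuous_map_gmult H.continuous_map_ginv continuous_map_J)
      (auto simp: H.rng_ginv)
  then show "continuous_map ?CT ?F ?g"
    unfolding left_fibre_product_def
    by (auto simp: continuous_map_in_subtopology H.src_ginv H.rng_ginv)
qed

text \<open>
A pair \<open>(p, p')\<close> is of the form \<open>(p, p k)\<close> exactly when both have the same range, and then
\<open>k = p\<inverse> p'\<close>, an arrow of \<open>\<H>\<close> with both ends in the subgroupoid and hence in the domain of \<open>\<theta>\<close>.
\<close>

lemma right_proper_linking:
  "right_proper \<K> X (\<lambda>p. \<kappa> (src \<H> (J p))) (\<lambda>p k. L (gmult \<H> (J p) (\<phi> k)))"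
  unfolding right_proper_def
proof (rule closed_embedding_imp_proper)
  let ?F = "right_fibre_product \<K> X (\<lambda>p. \<kappa> (src \<H> (J p)))"
  let ?C = "{z \<in> topspace (prod_topology X X). rng \<H> (J (fst z)) = rng \<H> (J (snd z))}"
  let ?d = "\<lambda>z. gmult \<H> (ginv \<H> (J (fst z))) (J (snd z))"
  let ?g = "\<lambda>z. (fst z, \<theta> (?d z))"
  have d: "?d z \<in> arrows \<H>" "src \<H> (?d z) = src \<H> (J (snd z))" "rng \<H> (?d z) = src \<H> (J (fst z))"
    "gmult \<H> (J (fst z)) (?d z) = J (snd z)" if "z \<in> ?C" for z
    using that by (auto simp: H.src_ginv H.rng_ginv H.ginv_cancel_left)
  have \<theta>d: "\<phi> (\<theta> (?d z)) = ?d z" "\<theta> (?d z) \<in> arrows \<K>" if "z \<in> ?C" for z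
    using that d[OF that] src_J by (auto intro!: \<phi>_\<theta> \<theta>_in)
  have "continuous_map ?F X (\<lambda>z. (case z of (p, k) \<Rightarrow> L (gmult \<H> (J p) (\<phi> k))))"
    using right_action_linking unfolding right_action_def by auto
  moreover have "continuous_map ?F X fst"
    by (auto simp: right_fibre_product_def intro!: continuous_map_from_subtopology continuous_map_fst)
  ultimately show "continuous_map ?F (prod_topology X X) (\<lambda>(p, k). (p, L (gmult \<H> (J p) (\<phi> k))))"
    by (simp add: continuous_map_paired case_prod_unfold)
  show "closedin (prod_topology X X) ?C"
    by (intro closedin_continuous_maps_eq[OF Hausdorff_objs_H] H.continuous_map_rng continuous_map_J
        continuous_map_fst continuous_map_snd)
  show "(case z of (p, k) \<Rightarrow> (p, L (gmult \<H> (J p) (\<phi> k)))) \<in> ?C" if "z \<in> topspace ?F" for z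
    using that by (auto simp: right_fibre_product_def right_mult rmom_eq_rng_iff)
  show "?g (case z of (p, k) \<Rightarrow> (p, L (gmult \<H> (J p) (\<phi> k)))) = z" if "z \<in> topspace ?F" for z
    using that by (auto simp: right_fibre_product_def right_mult rmom_eq_rng_iff H.ginv_cancel_left' \<theta>_\<phi>)
  show "(case ?g z of (p, k) \<Rightarrow> (p, L (gmult \<H> (J p) (\<phi> k)))) = z" if "z \<in> ?C" for z
    using that d(4)[OF that] \<theta>d[OF that] by (auto simp: L_J)
  let ?CT = "subtopology (prod_topology X X) ?C"
  have CT: "continuous_map ?CT X fst" "continuous_map ?CT X snd"
    by (auto intro!: continuous_map_from_subtopology continuous_map_fst continuous_map_snd)
  then have "continuous_map ?CT (arr_top \<H>) ?d"
    by (intro H.continuous_map_gmult H.continuous_map_ginv continuous_map_J)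
      (auto simp: H.src_ginv)
  then have "continuous_map ?CT (arr_top \<K>) (\<lambda>z. \<theta> (?d z))"
    by (rule continuous_map_\<theta>) (auto simp: d src_J simp del: H.src_mult H.rng_mult)
  then have "continuous_map ?CT (prod_topology X (arr_top \<K>)) ?g"
    using CT by (simp add: continuous_map_paired)
  moreover have "\<kappa> (src \<H> (J (fst z))) = rng \<K> (\<theta> (?d z))" if "z \<in> ?C" for z
    using rmom_eq_rng_iff[of "fst z" "\<theta> (?d z)"] that d(3)[OF that] \<theta>d[OF that] by auto
  ultimately show "continuous_map ?CT ?F ?g"
    unfolding right_fibre_product_def by (auto simp: continuous_map_in_subtopology)
qed

text \<open>
The right orbits are the fibres of the range map, and the left orbits those of the source map.
\<close>

lemma right_orbit_eq_iff:
  assumes p: "p \<in> topspace X" and q: "q \<in> topspace X"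
  shows "right_orbit \<K> (\<lambda>p. \<kappa> (src \<H> (J p))) (\<lambda>p k. L (gmult \<H> (J p) (\<phi> k))) p =
    right_orbit \<K> (\<lambda>p. \<kappa> (src \<H> (J p))) (\<lambda>p k. L (gmult \<H> (J p) (\<phi> k))) q \<longleftrightarrow>
    rng \<H> (J p) = rng \<H> (J q)"
proof -
  let ?O = "right_orbit \<K> (\<lambda>p. \<kappa> (src \<H> (J p))) (\<lambda>p k. L (gmult \<H> (J p) (\<phi> k)))"
  have "?O p = {r \<in> topspace X. rng \<H> (J r) = rng \<H> (J p)}" if p: "p \<in> topspace X" for p
  proof (intro equalityI subsetI)
    fix r assume "r \<in> ?O p"
    then show "r \<in> {r \<in> topspace X. rng \<H> (J r) = rng \<H> (J p)}"
      using p by (auto simp: right_orbit_def right_mult rmom_eq_rng_iff)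
  next
    fix r assume r: "r \<in> {r \<in> topspace X. rng \<H> (J r) = rng \<H> (J p)}"
    let ?h = "gmult \<H> (ginv \<H> (J p)) (J r)"
    have h: "?h \<in> arrows \<H>" "src \<H> ?h = src \<H> (J r)" "rng \<H> ?h = src \<H> (J p)" "gmult \<H> (J p) ?h = J r"
      using r p by (auto simp: H.src_ginv H.rng_ginv H.ginv_cancel_left)
    then have "\<phi> (\<theta> ?h) = ?h" "\<theta> ?h \<in> arrows \<K>"
      using r p src_J by (auto intro!: \<phi>_\<theta> \<theta>_in)
    moreover from this have "\<kappa> (src \<H> (J p)) = rng \<K> (\<theta> ?h)"
      using rmom_eq_rng_iff p h by metis
    ultimately show "r \<in> ?O p"
      unfolding right_orbit_def using r h by (auto intro!: exI[of _ "\<theta> ?h"] simp: L_J)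
  qed
  then show ?thesis using p q by auto
qed

lemma left_orbit_eq_iff:
  assumes p: "p \<in> topspace X" and q: "q \<in> topspace X"
  shows "left_orbit \<H> (\<lambda>p. rng \<H> (J p)) (\<lambda>h p. L (gmult \<H> h (J p))) p =
    left_orbit \<H> (\<lambda>p. rng \<H> (J p)) (\<lambda>h p. L (gmult \<H> h (J p))) q \<longleftrightarrow>
    \<kappa> (src \<H> (J p)) = \<kappa> (src \<H> (J q))"
proof -
  let ?O = "left_orbit \<H> (\<lambda>p. rng \<H> (J p)) (\<lambda>h p. L (gmult \<H> h (J p)))"
  have "?O p = {r \<in> topspace X. src \<H> (J r) = src \<H> (J p)}" if p: "p \<in> topspace X" for p
  proof (intro equalityI subsetI)
    fix r assume "r \<in> ?O p"
    then show "r \<in> {r \<in> topspace X. src \<H> (J r) = src \<H> (J p)}"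
      using p by (auto simp: left_orbit_def left_mult)
  next
    fix r assume r: "r \<in> {r \<in> topspace X. src \<H> (J r) = src \<H> (J p)}"
    let ?h = "gmult \<H> (J r) (ginv \<H> (J p))"
    have "?h \<in> arrows \<H>" "src \<H> ?h = rng \<H> (J p)" "gmult \<H> ?h (J p) = J r"
      using r p by (auto simp: H.src_ginv H.rng_ginv H.ginv_cancel_right)
    then show "r \<in> ?O p"
      unfolding left_orbit_def using r by (auto intro!: exI[of _ ?h] simp: L_J)
  qed
  moreover have "\<kappa> (src \<H> (J p)) = \<kappa> (src \<H> (J q)) \<longleftrightarrow> src \<H> (J p) = src \<H> (J q)"
    using \<iota>_\<kappa>_src p q by metis
  ultimately show ?thesis using p q by auto
qed

text \<open>
Since the orbits are the fibres of the moment maps, these induce homeomorphisms as soon as they are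
quotient maps.  For the range map this is assumed; the source map has the units of the subgroupoid as
a section.
\<close>

theorem morita_bimodule_linking: "morita_bimodule \<H> \<K> linking_bimodule"
  unfolding morita_bimodule_def linking_bimodule_def bimodule.simps
proof (intro conjI ballI impI)
  show "induces_homeomorphism X (right_orbit \<K> (\<lambda>p. \<kappa> (src \<H> (J p))) (\<lambda>p k. L (gmult \<H> (J p) (\<phi> k))))
      (obj_top \<H>) (\<lambda>p. rng \<H> (J p))"
    by (rule induces_homeomorphismI[OF rng_J_quotient right_orbit_eq_iff])
  have "quotient_map X (obj_top \<K>) (\<lambda>p. \<kappa> (src \<H> (J p)))"
  proof (rule quotient_map_section)
    show "continuous_map X (obj_top \<K>) (\<lambda>p. \<kappa> (src \<H> (J p)))"
      using right_action_linking by (simp add: right_action_def)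
    show "continuous_map (obj_top \<K>) X (\<lambda>x. L (ident \<H> (\<iota> x)))"
      by (intro continuous_map_L H.continuous_map_ident \<iota>_continuous) (simp add: H.src_ident)
    show "\<kappa> (src \<H> (J (L (ident \<H> (\<iota> x))))) = x" if "x \<in> objs \<K>" for x
      using that by (simp add: J_L H.src_ident \<kappa>_\<iota>)
  qed
  then show "induces_homeomorphism X (left_orbit \<H> (\<lambda>p. rng \<H> (J p)) (\<lambda>h p. L (gmult \<H> h (J p))))
      (obj_top \<K>) (\<lambda>p. \<kappa> (src \<H> (J p)))"
    by (rule induces_homeomorphismI[OF _ left_orbit_eq_iff])
next
  fix h p assume "h \<in> arrows \<H>" "p \<in> topspace X" "src \<H> h = rng \<H> (J p)"
  then show "\<kappa> (src \<H> (J (L (gmult \<H> h (J p))))) = \<kappa> (src \<H> (J p))"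
    by (simp add: left_mult)
next
  fix p k assume "p \<in> topspace X" "k \<in> arrows \<K>" "\<kappa> (src \<H> (J p)) = rng \<K> k"
  then show "rng \<H> (J (L (gmult \<H> (J p) (\<phi> k)))) = rng \<H> (J p)"
    by (simp add: right_mult rmom_eq_rng_iff)
next
  fix h p k assume "h \<in> arrows \<H>" "p \<in> topspace X" "k \<in> arrows \<K>"
    "src \<H> h = rng \<H> (J p) \<and> \<kappa> (src \<H> (J p)) = rng \<K> k"
  then show "L (gmult \<H> (J (L (gmult \<H> h (J p)))) (\<phi> k)) = L (gmult \<H> h (J (L (gmult \<H> (J p) (\<phi> k)))))"
    by (simp add: left_mult right_mult rmom_eq_rng_iff H.mult_assoc)
qed (fact Hausdorff_X locally_compact_X left_action_linking left_free_linking left_proper_linking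
    right_action_linking right_free_linking right_proper_linking)+

text \<open>
The cocycle \<open>\<psi>\<close> can be evaluated on \<open>\<H> \<times> P\<close> and on \<open>P \<times> \<K>\<close>, as \<open>P\<close> consists of arrows of \<open>\<H>\<close>.  The identities
for \<open>\<mu>\<close>, for \<open>\<nu>\<close> and for the pair are the cocycle identity at \<open>(h\<^sub>1, h\<^sub>2, p)\<close>, \<open>(p, k\<^sub>1, k\<^sub>2)\<close> and \<open>(h, p, k)\<close>.
\<close>

theorem cohomologous_on_linking:
  assumes \<psi>: "\<psi> \<in> cocycles2 \<H>"
    and eq: "\<And>k l. \<lbrakk>k \<in> arrows \<K>; l \<in> arrows \<K>; src \<K> k = rng \<K> l\<rbrakk> \<Longrightarrow> \<omega> (k, l) = \<psi> (\<phi> k, \<phi> l)"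
  shows "cohomologous_on \<H> \<psi> \<K> \<omega> linking_bimodule"
proof -
  let ?\<mu> = "\<lambda>(h, p). \<psi> (h, J p)" and ?\<nu> = "\<lambda>(p, k). \<psi> (J p, \<phi> k)"
  have c: "\<psi> \<in> cochain2 \<H>" using \<psi> unfolding cocycles2_def by blast
  let ?F = "left_fibre_product \<H> X (\<lambda>p. rng \<H> (J p))"
  have "continuous_map ?F (arr_top \<H>) fst" "continuous_map ?F X snd"
    by (auto simp: left_fibre_product_def intro!: continuous_map_from_subtopology
        continuous_map_fst continuous_map_snd)
  then have "continuous_map ?F U1 (\<lambda>z. \<psi> (fst z, J (snd z)))"
    by (intro H.continuous_map_cochain2[OF c] continuous_map_J) (auto simp: left_fibre_product_def)
  then have 1: "continuous_map ?F U1 ?\<mu>" by (simp add: case_prod_unfold)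
  let ?F = "right_fibre_product \<K> X (\<lambda>p. \<kappa> (src \<H> (J p)))"
  have "continuous_map ?F X fst" "continuous_map ?F (arr_top \<K>) snd"
    by (auto simp: right_fibre_product_def intro!: continuous_map_from_subtopology
        continuous_map_fst continuous_map_snd)
  then have "continuous_map ?F U1 (\<lambda>z. \<psi> (J (fst z), \<phi> (snd z)))"
    by (intro H.continuous_map_cochain2[OF c] continuous_map_J continuous_map_\<phi>)
      (auto simp: right_fibre_product_def rmom_eq_rng_iff)
  then have 2: "continuous_map ?F U1 ?\<nu>" by (simp add: case_prod_unfold)
  have 3: "\<psi> (h2, J p) * inverse (\<psi> (gmult \<H> h1 h2, J p)) * \<psi> (h1, J (L (gmult \<H> h2 (J p)))) = \<psi> (h1, h2)"
    if "h1 \<in> arrows \<H>" "h2 \<in> arrows \<H>" "src \<H> h1 = rng \<H> h2" "p \<in> topspace X" "src \<H> h2 = rng \<H> (J p)"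
    for h1 h2 p
    using H.cocycle2_eq[OF \<psi>, of h1 h2 "J p"] H.cochain2_nonzero[OF c, of "gmult \<H> h1 h2" "J p"] that
    by (simp add: left_mult field_simps)
  have 4: "\<psi> (J (L (gmult \<H> (J p) (\<phi> k1))), \<phi> k2) * inverse (\<psi> (J p, \<phi> (gmult \<K> k1 k2))) * \<psi> (J p, \<phi> k1) =
      \<omega> (k1, k2)"
    if "k1 \<in> arrows \<K>" "k2 \<in> arrows \<K>" "src \<K> k1 = rng \<K> k2" "p \<in> topspace X" "\<kappa> (src \<H> (J p)) = rng \<K> k1"
    for k1 k2 p
  proof -
    have "src \<H> (\<phi> k1) = rng \<H> (\<phi> k2)" "src \<H> (J p) = rng \<H> (\<phi> k1)"
      using that rmom_eq_rng_iff by (simp_all add: src_\<phi> rng_\<phi>)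
    then show ?thesis
      using H.cocycle2_eq[OF \<psi>, of "J p" "\<phi> k1" "\<phi> k2"]
        H.cochain2_nonzero[OF c, of "J p" "gmult \<H> (\<phi> k1) (\<phi> k2)"] that
      by (simp add: right_mult \<phi>_gmult eq field_simps)
  qed
  have 5: "\<psi> (h, J p) * \<psi> (J (L (gmult \<H> h (J p))), \<phi> k) = \<psi> (J p, \<phi> k) * \<psi> (h, J (L (gmult \<H> (J p) (\<phi> k))))"
    if "h \<in> arrows \<H>" "p \<in> topspace X" "k \<in> arrows \<K>" "src \<H> h = rng \<H> (J p)" "\<kappa> (src \<H> (J p)) = rng \<K> k"
    for h p k
    using H.cocycle2_eq[OF \<psi>, of h "J p" "\<phi> k"] that
    by (simp add: left_mult right_mult rmom_eq_rng_iff mult.commute)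
  show ?thesis
    unfolding cohomologous_on_def linking_bimodule_def bimodule.simps
    using 1 2 3 4 5 by (intro exI[of _ ?\<mu>] exI[of _ ?\<nu>]) auto
qed

end

section \<open>The crossed groupoid\<close>

locale lifted_homomorphism = closed_normal_subgroup G N + \<G>: locally_compact_groupoid \<G>
  for G :: "'g top_group" (structure) and N and \<G> :: "('o, 'a) groupoid" +
  fixes \<rho>bar :: "'a \<Rightarrow> 'g set" and \<rho> :: "'a \<Rightarrow> 'g"
  assumes \<rho>bar_hom: "groupoid_to_group_hom \<G> (G Mod N) (coset_top G N) \<rho>bar"
    and \<rho>_continuous: "continuous_map (arr_top \<G>) (grp_top G) \<rho>"
    and \<rho>_lift: "\<gamma> \<in> arrows \<G> \<Longrightarrow> N #> \<rho> \<gamma> = \<rho>bar \<gamma>"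
begin

abbreviation "\<H> \<equiv> crossed_groupoid G N \<G> \<rho>"
abbreviation "\<K> \<equiv> twisted_product_groupoid G N \<G> \<rho>"
abbreviation "\<M> \<equiv> coset_groupoid G N \<G> \<rho>bar"

lemma \<rho>_in [simp]: "\<gamma> \<in> arrows \<G> \<Longrightarrow> \<rho> \<gamma> \<in> carrier G"
  using continuous_map_funspace[OF \<rho>_continuous] by (auto simp: topspace_grp)

lemma continuous_map_\<rho>: "continuous_map X (arr_top \<G>) f \<Longrightarrow> continuous_map X TG (\<lambda>x. \<rho> (f x))"
  using continuous_map_compose[OF _ \<rho>_continuous] by (simp add: o_def)

text \<open>
Cosets are written as \<open>N #> a\<close> throughout, and computations take place with representatives.  The
lift \<open>\<rho>\<close> is multiplicative only modulo \<open>N\<close>, so a factor \<open>\<rho>(\<gamma>\<^sub>1\<gamma>\<^sub>2)\<close> may be split only under the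
projection to \<open>G/N\<close>; as \<open>N\<close> is normal, this is possible at every position of a product.
\<close>

lemma proj_cong: "\<lbrakk>x \<in> carrier G; b \<in> carrier G; c \<in> carrier G; N #> b = N #> c\<rbrakk> \<Longrightarrow> N #> (x \<otimes> b) = N #> (x \<otimes> c)"
  by (metis proj_mult_left)

lemma proj_\<rho>_mult:
  assumes "x \<in> carrier G" "\<gamma>1 \<in> arrows \<G>" "\<gamma>2 \<in> arrows \<G>" "src \<G> \<gamma>1 = rng \<G> \<gamma>2"
  shows "N #> (x \<otimes> \<rho> (gmult \<G> \<gamma>1 \<gamma>2)) = N #> (x \<otimes> \<rho> \<gamma>1 \<otimes> \<rho> \<gamma>2)"
proof -
  have "N #> \<rho> (gmult \<G> \<gamma>1 \<gamma>2) = \<rho>bar \<gamma>1 \<otimes>\<^bsub>G Mod N\<^esub> \<rho>bar \<gamma>2"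
    using \<rho>bar_hom assms \<G>.in_composable2[of \<gamma>1 \<gamma>2]
    by (fastforce simp: groupoid_to_group_hom_def \<rho>_lift)
  also have "\<dots> = N #> (\<rho> \<gamma>1 \<otimes> \<rho> \<gamma>2)"
    using assms by (simp add: FactGroup_def rcos_sum flip: \<rho>_lift)
  finally show ?thesis
    using assms proj_cong[of x "\<rho> (gmult \<G> \<gamma>1 \<gamma>2)" "\<rho> \<gamma>1 \<otimes> \<rho> \<gamma>2"] by (simp add: m_assoc)
qed

lemma proj_\<rho>_mult_right:
  assumes "x \<in> carrier G" "\<gamma>1 \<in> arrows \<G>" "\<gamma>2 \<in> arrows \<G>" "src \<G> \<gamma>1 = rng \<G> \<gamma>2" "b \<in> carrier G"
  shows "N #> (x \<otimes> \<rho> (gmult \<G> \<gamma>1 \<gamma>2) \<otimes> b) = N #> (x \<otimes> \<rho> \<gamma>1 \<otimes> \<rho> \<gamma>2 \<otimes> b)"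
  using arg_cong[OF proj_\<rho>_mult[OF assms(1-4)], of "\<lambda>t. t #> b"] assms by (simp add: proj_mult_right)

text \<open>
The image of a unit in \<open>G/N\<close> is idempotent, hence trivial.
\<close>

lemma \<rho>_ident_in:
  assumes "x \<in> objs \<G>"
  shows "\<rho> (ident \<G> x) \<in> N"
proof -
  let ?r = "\<rho> (ident \<G> x)"
  have r: "?r \<in> carrier G" using assms by simp
  have "gmult \<G> (ident \<G> x) (ident \<G> x) = ident \<G> x"
    using \<G>.ident_left[of "ident \<G> x"] assms by (simp add: \<G>.rng_ident)
  then have "N #> (inv ?r \<otimes> ?r) = N #> (inv ?r \<otimes> ?r \<otimes> ?r)"
    using proj_\<rho>_mult[of "inv ?r" "ident \<G> x" "ident \<G> x"] assms by (simp add: \<G>.src_ident \<G>.rng_ident)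
  then have "N #> ?r = N"
    using r by (simp add: coset_mult_one subset)
  then show ?thesis
    using r rcos_self[OF r is_subgroup] by simp
qed

lemma proj_\<rho>_ident:
  assumes "x \<in> carrier G" "y \<in> objs \<G>"
  shows "N #> (x \<otimes> \<rho> (ident \<G> y)) = N #> x"
  using assms proj_cong[of x "\<rho> (ident \<G> y)" \<one>] coset_join2[OF _ is_subgroup \<rho>_ident_in] coset_mult_one[OF subset]
  by simp

lemma proj_\<rho>_ginv:
  assumes "x \<in> carrier G" "\<gamma> \<in> arrows \<G>"
  shows "N #> (x \<otimes> \<rho> \<gamma> \<otimes> \<rho> (ginv \<G> \<gamma>)) = N #> x"
  using proj_\<rho>_mult[of x \<gamma> "ginv \<G> \<gamma>"] proj_\<rho>_ident[of x "rng \<G> \<gamma>"] assms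
  by (simp add: \<G>.rng_ginv \<G>.ginv_right)

lemma obj_top_\<H>: "obj_top \<H> = prod_topology TQ (obj_top \<G>)"
  and arr_top_\<H>: "arr_top \<H> = prod_topology TG (prod_topology TQ (arr_top \<G>))"
  and rng_\<H>: "rng \<H> (g, t, \<gamma>) = (t, rng \<G> \<gamma>)"
  and gmult_\<H>: "gmult \<H> (g, t, \<gamma>) (g', t', \<gamma>') = (g \<otimes> g', t, gmult \<G> \<gamma> \<gamma>')"
  and ident_\<H>: "ident \<H> (t, x) = (\<one>, t, ident \<G> x)"
  by (simp_all add: crossed_groupoid_def)

lemma arrows_\<H>E:
  assumes "h \<in> arrows \<H>"
  obtains g a \<gamma> where "h = (g, N #> a, \<gamma>)" "g \<in> carrier G" "a \<in> carrier G" "\<gamma> \<in> arrows \<G>"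
proof -
  obtain g t \<gamma> where h: "h = (g, t, \<gamma>)" by (cases h)
  then have "g \<in> carrier G" "t \<in> topspace TQ" "\<gamma> \<in> arrows \<G>"
    using assms by (auto simp: arr_top_\<H> topspace_grp)
  then show ?thesis
    using h that by (metis coset_topE)
qed

lemma objs_\<H>E:
  assumes "y \<in> objs \<H>"
  obtains a x where "y = (N #> a, x)" "a \<in> carrier G" "x \<in> objs \<G>"
  using assms by (cases y) (auto simp: obj_top_\<H> elim!: coset_topE)

lemma src_\<H>:
  "\<lbrakk>g \<in> carrier G; a \<in> carrier G; \<gamma> \<in> arrows \<G>\<rbrakk> \<Longrightarrow>
    src \<H> (g, N #> a, \<gamma>) = (N #> (inv g \<otimes> a \<otimes> \<rho> \<gamma>), src \<G> \<gamma>)"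
  by (simp add: crossed_groupoid_def proj_mult_left proj_mult_right)

lemma ginv_\<H>:
  "\<lbrakk>g \<in> carrier G; a \<in> carrier G; \<gamma> \<in> arrows \<G>\<rbrakk> \<Longrightarrow>
    ginv \<H> (g, N #> a, \<gamma>) = (inv g, N #> (inv g \<otimes> a \<otimes> \<rho> \<gamma>), ginv \<G> \<gamma>)"
  by (simp add: crossed_groupoid_def proj_mult_left proj_mult_right)

lemma composable_\<H>E:
  assumes "h \<in> arrows \<H>" "k \<in> arrows \<H>" "src \<H> h = rng \<H> k"
  obtains g a \<gamma> g' \<gamma>' where "h = (g, N #> a, \<gamma>)" "k = (g', N #> (inv g \<otimes> a \<otimes> \<rho> \<gamma>), \<gamma>')"
    "g \<in> carrier G" "a \<in> carrier G" "\<gamma> \<in> arrows \<G>" "g' \<in> carrier G" "\<gamma>' \<in> arrows \<G>"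
    "src \<G> \<gamma> = rng \<G> \<gamma>'"
proof -
  obtain g a \<gamma> where h: "h = (g, N #> a, \<gamma>)" "g \<in> carrier G" "a \<in> carrier G" "\<gamma> \<in> arrows \<G>"
    using assms(1) by (rule arrows_\<H>E)
  obtain g' a' \<gamma>' where k: "k = (g', N #> a', \<gamma>')" "g' \<in> carrier G" "a' \<in> carrier G" "\<gamma>' \<in> arrows \<G>"
    using assms(2) by (rule arrows_\<H>E)
  have "N #> a' = N #> (inv g \<otimes> a \<otimes> \<rho> \<gamma>)" "src \<G> \<gamma> = rng \<G> \<gamma>'"
    using assms(3) h k by (simp_all add: src_\<H> rng_\<H>)
  then show ?thesis
    using h k that by metis
qed

lemma continuous_map_components:
  "continuous_map (prod_topology X (prod_topology Y Z)) Y (\<lambda>z. fst (snd z))"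
  "continuous_map (prod_topology X (prod_topology Y Z)) Z (\<lambda>z. snd (snd z))"
  using continuous_map_compose[OF continuous_map_snd continuous_map_fst]
    continuous_map_compose[OF continuous_map_snd continuous_map_snd] by (auto simp: o_def)

text \<open>
Bracketing to the left turns everything before a factor \<open>\<rho>(\<gamma>)\<close> into a single left operand, which is
the form in which the rules for \<open>\<rho>\<close> under the projection apply.
\<close>

lemmas assoc_left = m_assoc[symmetric]

lemma topological_groupoid_\<H>: "topological_groupoid \<H>"
proof
  note c = continuous_map_fst continuous_map_components
  let ?A = "prod_topology TG (prod_topology TQ (arr_top \<G>))"
  have s: "continuous_map ?A TQ (\<lambda>z. (inv (fst z) <#\<^bsub>G\<^esub> fst (snd z)) #> \<rho> (snd (snd z)))"
    by (intro continuous_map_right_translation continuous_map_left_translation continuous_map_inv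
        continuous_map_\<rho> c)
  have "continuous_map ?A (prod_topology TQ (obj_top \<G>))
      (\<lambda>z. ((inv (fst z) <#\<^bsub>G\<^esub> fst (snd z)) #> \<rho> (snd (snd z)), src \<G> (snd (snd z))))"
    by (intro continuous_map_pairedI s \<G>.continuous_map_src c)
  then show "continuous_map (arr_top \<H>) (obj_top \<H>) (src \<H>)"
    by (simp add: crossed_groupoid_def case_prod_unfold)
  have "continuous_map ?A (prod_topology TQ (obj_top \<G>)) (\<lambda>z. (fst (snd z), rng \<G> (snd (snd z))))"
    by (intro continuous_map_pairedI \<G>.continuous_map_rng c)
  then show "continuous_map (arr_top \<H>) (obj_top \<H>) (rng \<H>)"
    by (simp add: crossed_groupoid_def case_prod_unfold)
  have "continuous_map (prod_topology TQ (obj_top \<G>)) ?A (\<lambda>z. (\<one>, fst z, ident \<G> (snd z)))"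
    by (intro continuous_map_pairedI \<G>.continuous_map_ident continuous_map_fst continuous_map_snd)
      (simp add: topspace_grp)
  then show "continuous_map (obj_top \<H>) (arr_top \<H>) (ident \<H>)"
    by (simp add: crossed_groupoid_def case_prod_unfold)
  have "continuous_map ?A ?A (\<lambda>z. (inv (fst z), (inv (fst z) <#\<^bsub>G\<^esub> fst (snd z)) #> \<rho> (snd (snd z)),
      ginv \<G> (snd (snd z))))"
    by (intro continuous_map_pairedI s \<G>.continuous_map_ginv continuous_map_inv c)
  then show "continuous_map (arr_top \<H>) (arr_top \<H>) (ginv \<H>)"
    by (simp add: crossed_groupoid_def case_prod_unfold)
  have c2: "continuous_map (composable2 \<H>) ?A fst" "continuous_map (composable2 \<H>) ?A snd"
    by (auto simp: composable2_def arr_top_\<H> intro!: continuous_map_from_subtopology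
        continuous_map_fst continuous_map_snd)
  note cc = continuous_map_compose[OF c2(1), unfolded o_def] continuous_map_compose[OF c2(2), unfolded o_def]
  have "continuous_map (composable2 \<H>) ?A (\<lambda>z. (fst (fst z) \<otimes> fst (snd z), fst (snd (fst z)),
      gmult \<G> (snd (snd (fst z))) (snd (snd (snd z)))))"
    by (intro continuous_map_pairedI continuous_map_mult \<G>.continuous_map_gmult cc c)
      (auto simp: composable2_def crossed_groupoid_def)
  then show "continuous_map (composable2 \<H>) (arr_top \<H>) (\<lambda>(a, b). gmult \<H> a b)"
    by (simp add: crossed_groupoid_def case_prod_unfold)
next
  fix y assume "y \<in> objs \<H>"
  then show "src \<H> (ident \<H> y) = y" "rng \<H> (ident \<H> y) = y"
    by (auto elim!: objs_\<H>E simp: ident_\<H> src_\<H> rng_\<H> proj_\<rho>_ident \<G>.src_ident \<G>.rng_ident)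
next
  fix h k assume "(h, k) \<in> topspace (composable2 \<H>)"
  then have "h \<in> arrows \<H>" "k \<in> arrows \<H>" "src \<H> h = rng \<H> k"
    by (auto simp: composable2_def)
  then show "src \<H> (gmult \<H> h k) = src \<H> k" "rng \<H> (gmult \<H> h k) = rng \<H> h"
    by (cases rule: composable_\<H>E;
        simp add: src_\<H> rng_\<H> gmult_\<H> proj_\<rho>_mult inv_mult_group assoc_left)+
next
  fix h k l assume "(h, k, l) \<in> topspace (composable3 \<H>)"
  then have "h \<in> arrows \<H>" "k \<in> arrows \<H>" "l \<in> arrows \<H>" "src \<H> h = rng \<H> k" "src \<H> k = rng \<H> l"
    by (auto simp: composable3_def)
  then show "gmult \<H> (gmult \<H> h k) l = gmult \<H> h (gmult \<H> k l)"
    by (elim arrows_\<H>E) (simp add: src_\<H> rng_\<H> gmult_\<H> m_assoc \<G>.mult_assoc)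
next
  fix h assume "h \<in> arrows \<H>"
  then obtain g a \<gamma> where h: "h = (g, N #> a, \<gamma>)" "g \<in> carrier G" "a \<in> carrier G" "\<gamma> \<in> arrows \<G>"
    by (rule arrows_\<H>E)
  then show "gmult \<H> (ident \<H> (rng \<H> h)) h = h" "gmult \<H> h (ident \<H> (src \<H> h)) = h"
    "gmult \<H> (ginv \<H> h) h = ident \<H> (src \<H> h)" "gmult \<H> h (ginv \<H> h) = ident \<H> (rng \<H> h)"
    by (simp_all add: src_\<H> rng_\<H> gmult_\<H> ident_\<H> ginv_\<H> \<G>.ident_left \<G>.ident_right \<G>.ginv_left \<G>.ginv_right)
  show "src \<H> (ginv \<H> h) = rng \<H> h" "rng \<H> (ginv \<H> h) = src \<H> h"
    using h by (simp_all add: src_\<H> rng_\<H> ginv_\<H> proj_\<rho>_ginv \<G>.src_ginv \<G>.rng_ginv assoc_left)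
qed

sublocale \<H>: topological_groupoid \<H>
  by (rule topological_groupoid_\<H>)

lemma locally_compact_groupoid_\<H>: "locally_compact_groupoid \<H>"
proof
  show "Hausdorff_space (arr_top \<H>)" "locally_compact_space (arr_top \<H>)"
    by (simp_all add: arr_top_\<H> Hausdorff_space_prod_topology locally_compact_space_prod_topology
        Hausdorff_grp Hausdorff_coset_top \<G>.Hausdorff_arr locally_compact_grp locally_compact_coset_top
        \<G>.locally_compact_arr)
qed

end

section \<open>The cocycle on the crossed groupoid\<close>

lemma U1_mult:
  assumes "continuous_map X U1 f" "continuous_map X U1 g"
  shows "continuous_map X U1 (\<lambda>x. f x * g x)"
proof -
  have fg: "continuous_map X euclidean f" "continuous_map X euclidean g"
    and n: "\<And>x. x \<in> topspace X \<Longrightarrow> norm (f x) = 1 \<and> norm (g x) = 1"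
    using assms by (auto simp: U1_def continuous_map_in_subtopology Pi_iff)
  have "continuous_map X euclidean (\<lambda>x. (f x, g x))"
    using continuous_map_pairedI[OF fg] by simp
  moreover have "continuous_map euclidean euclidean (\<lambda>z. fst z * snd z :: complex)"
    by (auto intro!: continuous_intros)
  ultimately have "continuous_map X euclidean ((\<lambda>z. fst z * snd z) \<circ> (\<lambda>x. (f x, g x)))"
    by (rule continuous_map_compose)
  then show ?thesis
    using n by (auto simp: U1_def continuous_map_in_subtopology o_def norm_mult)
qed

text \<open>
The bookkeeping behind \<open>psi_cocycle\<close>.  The hypotheses are, in this order, \<open>d\<sigma> = \<delta>\<Lambda>\<close>, \<open>\<delta>\<sigma> = 1\<close>,
\<open>\<delta>\<beta> d\<Lambda> = 1\<close> and \<open>d\<beta> = 1\<close>.  The letters \<open>S\<close>, \<open>Q\<close>, \<open>U\<close>, \<open>W\<close> stand for values of \<open>\<sigma>\<close>,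
\<open>L\<close> and \<open>M\<close> for values of \<open>\<Lambda>\<close>, and \<open>P\<close>, \<open>R\<close>, \<open>V\<close>, \<open>B\<close> for values of \<open>\<beta>\<close>.
\<close>

lemma cocycle_algebra:
  fixes S S' :: "'a :: comm_monoid_mult"
  assumes "S' * L12 = S * L2 * L1"
    and "S * Q = U * W"
    and "B3 * M * L2 = B12 * M12"
    and "P * R = V * B3"
  shows "(S' * M * P) * (Q * L12 * R) = (U * M12 * V) * (W * L1 * B12)"
proof -
  have "(S' * M * P) * (Q * L12 * R) = (S' * L12) * M * (P * R) * Q"
    by (simp only: mult_ac)
  also have "\<dots> = (S * L2 * L1) * M * (V * B3) * Q"
    by (simp only: assms)
  also have "\<dots> = (S * Q) * L1 * V * (B3 * M * L2)"
    by (simp only: mult_ac)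
  also have "\<dots> = (U * W) * L1 * V * (B12 * M12)"
    by (simp only: assms)
  also have "\<dots> = (U * M12 * V) * (W * L1 * B12)"
    by (simp only: mult_ac)
  finally show ?thesis .
qed

locale equivariant_cocycle = lifted_homomorphism G N \<G> \<rho>bar \<rho>
  for G :: "'g top_group" (structure) and N and \<G> :: "('o, 'a) groupoid" and \<rho>bar \<rho> +
  fixes \<sigma> :: "('g set \<times> 'a) \<times> ('g set \<times> 'a) \<Rightarrow> complex"
    and \<Lambda> :: "'g \<times> 'g set \<times> 'a \<Rightarrow> complex"
    and \<beta> :: "'g \<times> 'g \<times> 'g set \<times> 'o \<Rightarrow> complex"
  assumes cocycle: "(\<sigma>, \<Lambda>, \<beta>) \<in> equivariant_cocycles2 G (coset_groupoid G N \<G> \<rho>bar) (translate G) (translate G)"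
begin

abbreviation "\<psi> \<equiv> psi G \<G> \<rho> \<sigma> \<Lambda> \<beta>"

text \<open>
The three components as functions of a representative \<open>a\<close> of the \<open>G/N\<close>-coordinate.
\<close>

abbreviation "S a \<gamma>1 \<gamma>2 \<equiv> \<sigma> ((N #> a, \<gamma>1), (N #> (a \<otimes> \<rho> \<gamma>1), \<gamma>2))"
abbreviation "Lm g a \<gamma> \<equiv> \<Lambda> (g, N #> a, \<gamma>)"
abbreviation "B g1 g2 a x \<equiv> \<beta> (g1, g2, N #> a, x)"

lemma continuous_\<sigma>: "continuous_map (composable2 \<M>) U1 \<sigma>"
  and continuous_\<Lambda>: "continuous_map (prod_topology TG (prod_topology TQ (arr_top \<G>))) U1 \<Lambda>"
  and continuous_\<beta>: "continuous_map (prod_topology TG (prod_topology TG (prod_topology TQ (obj_top \<G>)))) U1 \<beta>"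
  using cocycle
  by (auto simp: equivariant_cocycles2_def cochain2_def group_cochain1_1_def group_cochain2_0_def
      coset_groupoid_def)

lemma \<M>_simps:
  "obj_top \<M> = prod_topology TQ (obj_top \<G>)" "arr_top \<M> = prod_topology TQ (arr_top \<G>)"
  "rng \<M> (t, \<gamma>) = (t, rng \<G> \<gamma>)" "ident \<M> (t, x) = (t, ident \<G> x)"
  "gmult \<M> (t, \<gamma>) (t', \<gamma>') = (t, gmult \<G> \<gamma> \<gamma>')"
  by (simp_all add: coset_groupoid_def)

lemma src_\<M>:
  "\<lbrakk>a \<in> carrier G; \<gamma> \<in> arrows \<G>\<rbrakk> \<Longrightarrow> src \<M> (N #> a, \<gamma>) = (N #> (a \<otimes> \<rho> \<gamma>), src \<G> \<gamma>)"
  by (simp add: coset_groupoid_def FactGroup_def rcos_sum flip: \<rho>_lift)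

lemma in_composable2_\<M>:
  "\<lbrakk>a \<in> carrier G; \<gamma>1 \<in> arrows \<G>; \<gamma>2 \<in> arrows \<G>; src \<G> \<gamma>1 = rng \<G> \<gamma>2\<rbrakk> \<Longrightarrow>
    ((N #> a, \<gamma>1), (N #> (a \<otimes> \<rho> \<gamma>1), \<gamma>2)) \<in> topspace (composable2 \<M>)"
  by (auto simp: composable2_def \<M>_simps src_\<M>)

lemma in_composable3_\<M>:
  "\<lbrakk>a \<in> carrier G; \<gamma>1 \<in> arrows \<G>; \<gamma>2 \<in> arrows \<G>; \<gamma>3 \<in> arrows \<G>; src \<G> \<gamma>1 = rng \<G> \<gamma>2; src \<G> \<gamma>2 = rng \<G> \<gamma>3\<rbrakk> \<Longrightarrow>
    ((N #> a, \<gamma>1), (N #> (a \<otimes> \<rho> \<gamma>1), \<gamma>2), (N #> (a \<otimes> \<rho> \<gamma>1 \<otimes> \<rho> \<gamma>2), \<gamma>3)) \<in> topspace (composable3 \<M>)"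
  by (auto simp: composable3_def \<M>_simps src_\<M>)

lemma U1_nonzero: "z \<in> topspace U1 \<Longrightarrow> z \<noteq> 0"
  by (auto simp: U1_def)

lemma \<sigma>_nonzero:
  "\<lbrakk>a \<in> carrier G; \<gamma>1 \<in> arrows \<G>; \<gamma>2 \<in> arrows \<G>; src \<G> \<gamma>1 = rng \<G> \<gamma>2\<rbrakk> \<Longrightarrow> S a \<gamma>1 \<gamma>2 \<noteq> 0"
  using funcset_mem[OF continuous_map_funspace[OF continuous_\<sigma>] in_composable2_\<M>] U1_nonzero by metis

lemma \<Lambda>_nonzero: "\<lbrakk>g \<in> carrier G; a \<in> carrier G; \<gamma> \<in> arrows \<G>\<rbrakk> \<Longrightarrow> Lm g a \<gamma> \<noteq> 0"
  using funcset_mem[OF continuous_map_funspace[OF continuous_\<Lambda>], of "(g, N #> a, \<gamma>)"] U1_nonzero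
  by (simp add: topspace_grp)

lemma \<beta>_nonzero:
  "\<lbrakk>g1 \<in> carrier G; g2 \<in> carrier G; a \<in> carrier G; x \<in> objs \<G>\<rbrakk> \<Longrightarrow> B g1 g2 a x \<noteq> 0"
  using funcset_mem[OF continuous_map_funspace[OF continuous_\<beta>], of "(g1, g2, N #> a, x)"] U1_nonzero
  by (simp add: topspace_grp)

lemma \<sigma>_cocycle:
  assumes "a \<in> carrier G" "\<gamma>1 \<in> arrows \<G>" "\<gamma>2 \<in> arrows \<G>" "\<gamma>3 \<in> arrows \<G>"
    "src \<G> \<gamma>1 = rng \<G> \<gamma>2" "src \<G> \<gamma>2 = rng \<G> \<gamma>3"
  shows "S (a \<otimes> \<rho> \<gamma>1) \<gamma>2 \<gamma>3 * S a \<gamma>1 (gmult \<G> \<gamma>2 \<gamma>3) = S a (gmult \<G> \<gamma>1 \<gamma>2) \<gamma>3 * S a \<gamma>1 \<gamma>2"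
proof -
  have "\<forall>z \<in> topspace (composable3 \<M>). delta2 \<M> \<sigma> z = 1"
    using cocycle by (simp add: equivariant_cocycles2_def)
  from this[rule_format, OF in_composable3_\<M>[OF assms]]
  have "S (a \<otimes> \<rho> \<gamma>1) \<gamma>2 \<gamma>3 * inverse (S a (gmult \<G> \<gamma>1 \<gamma>2) \<gamma>3) * S a \<gamma>1 (gmult \<G> \<gamma>2 \<gamma>3) * inverse (S a \<gamma>1 \<gamma>2) = 1"
    using assms by (simp add: delta2_def \<M>_simps proj_\<rho>_mult)
  moreover have "S a (gmult \<G> \<gamma>1 \<gamma>2) \<gamma>3 \<noteq> 0" "S a \<gamma>1 \<gamma>2 \<noteq> 0"
    using assms by (simp_all add: \<sigma>_nonzero)
  ultimately show ?thesis by (simp add: field_simps)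
qed

lemma \<sigma>_translate:
  assumes "g \<in> carrier G" "a \<in> carrier G" "\<gamma>1 \<in> arrows \<G>" "\<gamma>2 \<in> arrows \<G>" "src \<G> \<gamma>1 = rng \<G> \<gamma>2"
  shows "S (inv g \<otimes> a) \<gamma>1 \<gamma>2 * Lm g a (gmult \<G> \<gamma>1 \<gamma>2) = S a \<gamma>1 \<gamma>2 * Lm g (a \<otimes> \<rho> \<gamma>1) \<gamma>2 * Lm g a \<gamma>1"
proof -
  have "\<forall>g \<in> carrier G. \<forall>(h1, h2) \<in> topspace (composable2 \<M>).
        gd0 G (\<lambda>g (h1, h2). (translate G g h1, translate G g h2)) \<sigma> (g, h1, h2) =
        delta1 \<M> (\<lambda>h. \<Lambda> (g, h)) (h1, h2)"
    using cocycle by (simp add: equivariant_cocycles2_def)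
  then have "gd0 G (\<lambda>g (h1, h2). (translate G g h1, translate G g h2)) \<sigma>
      (g, (N #> a, \<gamma>1), (N #> (a \<otimes> \<rho> \<gamma>1), \<gamma>2)) =
      delta1 \<M> (\<lambda>h. \<Lambda> (g, h)) ((N #> a, \<gamma>1), (N #> (a \<otimes> \<rho> \<gamma>1), \<gamma>2))"
    using in_composable2_\<M> assms by blast
  then have "S (inv g \<otimes> a) \<gamma>1 \<gamma>2 * inverse (S a \<gamma>1 \<gamma>2) =
      Lm g (a \<otimes> \<rho> \<gamma>1) \<gamma>2 * inverse (Lm g a (gmult \<G> \<gamma>1 \<gamma>2)) * Lm g a \<gamma>1"
    using assms by (simp add: gd0_def delta1_def translate_def \<M>_simps proj_mult_left assoc_left)
  then show ?thesis
    using assms \<sigma>_nonzero[of a \<gamma>1 \<gamma>2] \<Lambda>_nonzero[of g a "gmult \<G> \<gamma>1 \<gamma>2"] by (simp add: field_simps)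
qed

lemma \<Lambda>_multiplicative:
  assumes "g1 \<in> carrier G" "g2 \<in> carrier G" "a \<in> carrier G" "\<gamma> \<in> arrows \<G>"
  shows "B g1 g2 (a \<otimes> \<rho> \<gamma>) (src \<G> \<gamma>) * Lm g2 (inv g1 \<otimes> a) \<gamma> * Lm g1 a \<gamma> =
    B g1 g2 a (rng \<G> \<gamma>) * Lm (g1 \<otimes> g2) a \<gamma>"
proof -
  have "\<forall>g1 \<in> carrier G. \<forall>g2 \<in> carrier G. \<forall>h \<in> arrows \<M>.
        delta0 \<M> (\<lambda>x. \<beta> (g1, g2, x)) h * gd1 G (translate G) \<Lambda> (g1, g2, h) = 1"
    using cocycle by (simp add: equivariant_cocycles2_def)
  then have "delta0 \<M> (\<lambda>x. \<beta> (g1, g2, x)) (N #> a, \<gamma>) * gd1 G (translate G) \<Lambda> (g1, g2, (N #> a, \<gamma>)) = 1"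
    using assms by (simp add: \<M>_simps)
  then have "B g1 g2 (a \<otimes> \<rho> \<gamma>) (src \<G> \<gamma>) * inverse (B g1 g2 a (rng \<G> \<gamma>)) *
      (Lm g2 (inv g1 \<otimes> a) \<gamma> * inverse (Lm (g1 \<otimes> g2) a \<gamma>) * Lm g1 a \<gamma>) = 1"
    using assms by (simp add: delta0_def gd1_def translate_def \<M>_simps src_\<M> proj_mult_left)
  then show ?thesis
    using assms \<beta>_nonzero[of g1 g2 a "rng \<G> \<gamma>"] \<Lambda>_nonzero[of "g1 \<otimes> g2" a \<gamma>] by (simp add: field_simps)
qed

lemma \<beta>_cocycle:
  assumes "g1 \<in> carrier G" "g2 \<in> carrier G" "g3 \<in> carrier G" "a \<in> carrier G" "x \<in> objs \<G>"
  shows "B g2 g3 (inv g1 \<otimes> a) x * B g1 (g2 \<otimes> g3) a x = B (g1 \<otimes> g2) g3 a x * B g1 g2 a x"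
proof -
  have "\<forall>g1 \<in> carrier G. \<forall>g2 \<in> carrier G. \<forall>g3 \<in> carrier G. \<forall>x \<in> objs \<M>. gd2 G (translate G) \<beta> (g1, g2, g3, x) = 1"
    using cocycle by (simp add: equivariant_cocycles2_def)
  then have "gd2 G (translate G) \<beta> (g1, g2, g3, (N #> a, x)) = 1"
    using assms by (simp add: \<M>_simps)
  then show ?thesis
    using assms \<beta>_nonzero[of "g1 \<otimes> g2" g3 a x] \<beta>_nonzero[of g1 g2 a x]
    by (simp add: gd2_def translate_def proj_mult_left field_simps)
qed

lemma \<psi>_eq:
  "\<lbrakk>a \<in> carrier G; \<gamma>1 \<in> arrows \<G>; \<gamma>2 \<in> arrows \<G>\<rbrakk> \<Longrightarrow>
    \<psi> ((g1, N #> a, \<gamma>1), (g2, t, \<gamma>2)) =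
      S a \<gamma>1 \<gamma>2 * Lm g1 (a \<otimes> \<rho> \<gamma>1) \<gamma>2 * B g1 g2 (a \<otimes> \<rho> \<gamma>1 \<otimes> \<rho> \<gamma>2) (src \<G> \<gamma>2)"
  by (simp add: psi_def proj_mult_right)

lemma \<sigma>_normalized:
  assumes "a \<in> carrier G" "\<gamma> \<in> arrows \<G>"
  shows "S a (ident \<G> (rng \<G> \<gamma>)) \<gamma> = 1" "S a \<gamma> (ident \<G> (src \<G> \<gamma>)) = 1"
proof -
  have *: "\<forall>h \<in> arrows \<M>. \<sigma> (ident \<M> (rng \<M> h), h) = 1 \<and> \<sigma> (h, ident \<M> (src \<M> h)) = 1"
    using cocycle by (auto simp: equivariant_cocycles2_def cochain2_def)
  have "(N #> a, \<gamma>) \<in> arrows \<M>" using assms by (simp add: \<M>_simps)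
  with * show "S a (ident \<G> (rng \<G> \<gamma>)) \<gamma> = 1" "S a \<gamma> (ident \<G> (src \<G> \<gamma>)) = 1"
    using assms by (fastforce simp: \<M>_simps src_\<M> proj_\<rho>_ident)+
qed

lemma \<Lambda>_normalized:
  assumes "a \<in> carrier G"
  shows "\<gamma> \<in> arrows \<G> \<Longrightarrow> Lm \<one> a \<gamma> = 1" "\<lbrakk>g \<in> carrier G; x \<in> objs \<G>\<rbrakk> \<Longrightarrow> Lm g a (ident \<G> x) = 1"
  using cocycle assms
  by (force simp: equivariant_cocycles2_def group_cochain1_1_def cochain1_def \<M>_simps)+

lemma \<beta>_normalized:
  assumes "a \<in> carrier G" "g \<in> carrier G" "x \<in> objs \<G>"
  shows "B \<one> g a x = 1" "B g \<one> a x = 1"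
  using cocycle assms
  by (auto simp: equivariant_cocycles2_def group_cochain2_0_def \<M>_simps)

text \<open>
For composable \<open>h\<close>, \<open>k\<close>, \<open>l\<close> with \<open>h = (g\<^sub>1, N a, \<gamma>\<^sub>1)\<close>, the arrow \<open>k\<close> lives over the translate of
\<open>N a \<rho>(\<gamma>\<^sub>1)\<close> by \<open>g\<^sub>1\<inverse>\<close>.  Comparing \<open>\<sigma>\<close> there with its value over \<open>N a \<rho>(\<gamma>\<^sub>1)\<close> costs a coboundary
\<open>\<delta>\<Lambda>\<close>.  Together with the factors \<open>\<Lambda>\<close> of \<open>\<psi>\<close> it leaves \<open>d\<Lambda>\<close>, which moves the argument of \<open>\<beta>\<close>
from the range to the source of \<open>\<gamma>\<^sub>3\<close>, where \<open>d\<beta> = 1\<close> applies.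
\<close>

theorem psi_cocycle: "\<psi> \<in> cocycles2 \<H>"
proof -
  let ?A = "prod_topology TG (prod_topology TQ (arr_top \<G>))"
  have c2: "continuous_map (composable2 \<H>) ?A fst" "continuous_map (composable2 \<H>) ?A snd"
    by (auto simp: composable2_def arr_top_\<H> intro!: continuous_map_from_subtopology
        continuous_map_fst continuous_map_snd)
  note c = continuous_map_compose[OF c2(1), unfolded o_def] continuous_map_compose[OF c2(2), unfolded o_def]
    continuous_map_fst continuous_map_components
  let ?t = "\<lambda>z. fst (snd (fst z)) #> \<rho> (snd (snd (fst z)))"
  let ?s = "\<lambda>z. ((fst (snd (fst z)), snd (snd (fst z))), (?t z, snd (snd (snd z))))"
  have t: "continuous_map (composable2 \<H>) TQ ?t"
    by (intro continuous_map_right_translation continuous_map_\<rho> c)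
  have "continuous_map (composable2 \<H>) (prod_topology (prod_topology TQ (arr_top \<G>)) (prod_topology TQ (arr_top \<G>))) ?s"
    by (intro continuous_map_pairedI t c)
  moreover have "?s z \<in> topspace (composable2 \<M>)" if "z \<in> topspace (composable2 \<H>)" for z
  proof -
    obtain h k where z: "z = (h, k)" by (cases z)
    with that have "h \<in> arrows \<H>" "k \<in> arrows \<H>" "src \<H> h = rng \<H> k" by simp_all
    then show ?thesis unfolding z
      by (cases rule: composable_\<H>E) (simp add: in_composable2_\<M> proj_mult_right)
  qed
  ultimately have "continuous_map (composable2 \<H>) (composable2 \<M>) ?s"
    by (auto simp: composable2_def[of \<M>] continuous_map_in_subtopology \<M>_simps)
  from continuous_map_compose[OF this continuous_\<sigma>]
  have 1: "continuous_map (composable2 \<H>) U1 (\<lambda>z. \<sigma> (?s z))"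
    by (simp add: o_def)
  have "continuous_map (composable2 \<H>) ?A (\<lambda>z. (fst (fst z), ?t z, snd (snd (snd z))))"
    by (intro continuous_map_pairedI t c)
  from continuous_map_compose[OF this continuous_\<Lambda>]
  have 2: "continuous_map (composable2 \<H>) U1 (\<lambda>z. \<Lambda> (fst (fst z), ?t z, snd (snd (snd z))))"
    by (simp add: o_def)
  have "continuous_map (composable2 \<H>) (prod_topology TG (prod_topology TG (prod_topology TQ (obj_top \<G>))))
    (\<lambda>z. (fst (fst z), fst (snd z), ?t z #> \<rho> (snd (snd (snd z))), src \<G> (snd (snd (snd z)))))"
    by (intro continuous_map_pairedI continuous_map_right_translation[OF t] continuous_map_\<rho> \<G>.continuous_map_src c)
  from continuous_map_compose[OF this continuous_\<beta>]
  have 3: "continuous_map (composable2 \<H>) U1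
      (\<lambda>z. \<beta> (fst (fst z), fst (snd z), ?t z #> \<rho> (snd (snd (snd z))), src \<G> (snd (snd (snd z)))))"
    by (simp add: o_def)
  have "continuous_map (composable2 \<H>) U1 \<psi>"
    using U1_mult[OF U1_mult[OF 1 2] 3] by (simp add: psi_def case_prod_unfold)
  moreover have "\<psi> (ident \<H> (rng \<H> h), h) = 1 \<and> \<psi> (h, ident \<H> (src \<H> h)) = 1" if "h \<in> arrows \<H>" for h
    using that
    by (cases rule: arrows_\<H>E)
      (simp add: rng_\<H> src_\<H> ident_\<H> \<psi>_eq \<sigma>_normalized \<Lambda>_normalized \<beta>_normalized)
  moreover have "delta2 \<H> \<psi> (h, k, l) = 1" if "(h, k, l) \<in> topspace (composable3 \<H>)" for h k l
  proof -
    have hkl: "h \<in> arrows \<H>" "k \<in> arrows \<H>" "l \<in> arrows \<H>" "src \<H> h = rng \<H> k" "src \<H> k = rng \<H> l"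
      using that by simp_all
    obtain g1 a \<gamma>1 g2 \<gamma>2 where h: "h = (g1, N #> a, \<gamma>1)" "k = (g2, N #> (inv g1 \<otimes> a \<otimes> \<rho> \<gamma>1), \<gamma>2)"
      "g1 \<in> carrier G" "a \<in> carrier G" "\<gamma>1 \<in> arrows \<G>" "g2 \<in> carrier G" "\<gamma>2 \<in> arrows \<G>" "src \<G> \<gamma>1 = rng \<G> \<gamma>2"
      using hkl(1,2,4) by (rule composable_\<H>E)
    obtain g3 t \<gamma>3 where l: "l = (g3, t, \<gamma>3)" "g3 \<in> carrier G" "\<gamma>3 \<in> arrows \<G>"
      using hkl(3) by (rule arrows_\<H>E)
    have s: "src \<G> \<gamma>2 = rng \<G> \<gamma>3"
      using hkl(5) h l by (simp add: src_\<H> rng_\<H>)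
    have "\<psi> (k, l) * \<psi> (h, gmult \<H> k l) = \<psi> (gmult \<H> h k, l) * \<psi> (h, k)"
    proof -
      let ?b = "a \<otimes> \<rho> \<gamma>1"
      let ?c = "a \<otimes> \<rho> \<gamma>1 \<otimes> \<rho> \<gamma>2"
      let ?d = "a \<otimes> \<rho> \<gamma>1 \<otimes> \<rho> \<gamma>2 \<otimes> \<rho> \<gamma>3"
      have "S (inv g1 \<otimes> ?b) \<gamma>2 \<gamma>3 * Lm g2 (inv g1 \<otimes> ?c) \<gamma>3 * B g2 g3 (inv g1 \<otimes> ?d) (src \<G> \<gamma>3) *
        (S a \<gamma>1 (gmult \<G> \<gamma>2 \<gamma>3) * Lm g1 ?b (gmult \<G> \<gamma>2 \<gamma>3) * B g1 (g2 \<otimes> g3) ?d (src \<G> \<gamma>3)) =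
        S a (gmult \<G> \<gamma>1 \<gamma>2) \<gamma>3 * Lm (g1 \<otimes> g2) ?c \<gamma>3 * B (g1 \<otimes> g2) g3 ?d (src \<G> \<gamma>3) *
        (S a \<gamma>1 \<gamma>2 * Lm g1 ?b \<gamma>2 * B g1 g2 ?c (src \<G> \<gamma>2))"
        by (rule cocycle_algebra[OF \<sigma>_translate \<sigma>_cocycle _ \<beta>_cocycle])
         (use h l s \<Lambda>_multiplicative[of g1 g2 ?c \<gamma>3] in simp_all)
      then show ?thesis
        using h l s by (simp add: \<psi>_eq gmult_\<H> proj_\<rho>_mult proj_\<rho>_mult_right assoc_left)
    qed
    moreover have "\<psi> (gmult \<H> h k, l) \<noteq> 0" "\<psi> (h, k) \<noteq> 0"
      using h l s by (simp_all add: \<psi>_eq gmult_\<H> \<sigma>_nonzero \<Lambda>_nonzero \<beta>_nonzero)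
    ultimately show ?thesis by (simp add: delta2_def field_simps)
  qed
  ultimately show ?thesis
    by (auto simp: cocycles2_def cochain2_def)
qed

end

section \<open>The twisted product as a full subgroupoid of the crossed groupoid\<close>

context lifted_homomorphism
begin

abbreviation "base_inclusion \<equiv> \<lambda>x :: 'o. (N, x)"
abbreviation "subgroupoid_inclusion \<equiv> \<lambda>(n, \<gamma>). (n \<otimes> \<rho> \<gamma>, N, \<gamma>)"
abbreviation "subgroupoid_coordinates \<equiv> \<lambda>(g, t :: 'g set, \<gamma>). (g \<otimes> inv (\<rho> \<gamma>), \<gamma>)"

lemma N_eq: "N = N #> \<one>"
  by (simp add: coset_mult_one subset)

lemma N_in_carrier [simp]: "n \<in> N \<Longrightarrow> n \<in> carrier G"
  using subset by auto

lemma src_\<H>_N: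
  "\<lbrakk>g \<in> carrier G; \<gamma> \<in> arrows \<G>\<rbrakk> \<Longrightarrow> src \<H> (g, N, \<gamma>) = (N #> (inv g \<otimes> \<rho> \<gamma>), src \<G> \<gamma>)"
  using src_\<H>[of g \<one> \<gamma>] by (simp flip: N_eq)

lemma proj_inverse_eq_N_iff:
  assumes "g \<in> carrier G" "b \<in> carrier G"
  shows "N #> (inv g \<otimes> b) = N \<longleftrightarrow> N #> b = N #> g"
proof
  assume "N #> (inv g \<otimes> b) = N"
  then have "N #> (g \<otimes> (inv g \<otimes> b)) = N #> (g \<otimes> \<one>)"
    using assms N_eq by (intro proj_cong) auto
  then show "N #> b = N #> g" using assms by (simp add: assoc_left)
next
  assume "N #> b = N #> g"
  then have "N #> (inv g \<otimes> b) = N #> (inv g \<otimes> g)"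
    using assms by (intro proj_cong) auto
  then show "N #> (inv g \<otimes> b) = N" using assms N_eq by simp
qed

lemma \<K>_simps:
  "obj_top \<K> = obj_top \<G>" "arr_top \<K> = prod_topology (subtopology TG N) (arr_top \<G>)"
  "src \<K> (n, \<gamma>) = src \<G> \<gamma>" "rng \<K> (n, \<gamma>) = rng \<G> \<gamma>"
  by (simp_all add: twisted_product_groupoid_def)

lemma subgroupoid_inclusion_base:
  assumes "n \<in> N" "\<gamma> \<in> arrows \<G>"
  shows "src \<H> (n \<otimes> \<rho> \<gamma>, N, \<gamma>) = (N, src \<G> \<gamma>)"
  using assms proj_inverse_eq_N_iff[of "n \<otimes> \<rho> \<gamma>" "\<rho> \<gamma>"] proj_eq_iff[of "\<rho> \<gamma>" "n \<otimes> \<rho> \<gamma>"]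
  by (simp add: src_\<H>_N inv_mult_group assoc_left)

text \<open>
Here \<open>N\<close> enters: an arrow \<open>(g, N, \<gamma>)\<close> ends over \<open>N\<close> and starts over \<open>g\<inverse> N \<rho>(\<gamma>)\<close>, and the latter is
\<open>N\<close> if and only if \<open>g \<rho>(\<gamma>)\<inverse> \<in> N\<close>.
\<close>

lemma coordinates_in_N:
  assumes "h \<in> arrows \<H>" "src \<H> h \<in> base_inclusion ` objs \<G>" "rng \<H> h \<in> base_inclusion ` objs \<G>"
  obtains g \<gamma> where "h = (g, N, \<gamma>)" "g \<in> carrier G" "\<gamma> \<in> arrows \<G>" "g \<otimes> inv (\<rho> \<gamma>) \<in> N"
proof -
  obtain g a \<gamma> where h: "h = (g, N #> a, \<gamma>)" "g \<in> carrier G" "a \<in> carrier G" "\<gamma> \<in> arrows \<G>"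
    using assms(1) by (rule arrows_\<H>E)
  have a: "N #> a = N" using assms(3) h by (auto simp: rng_\<H>)
  then have "N #> (inv g \<otimes> \<rho> \<gamma>) = N"
    using assms(2) h by (auto simp: src_\<H>_N)
  then have "g \<otimes> inv (\<rho> \<gamma>) \<in> N"
    using h proj_inverse_eq_N_iff proj_eq_iff[of g "\<rho> \<gamma>"] by simp
  then show ?thesis using that h a by simp
qed

lemma full_subgroupoid_\<K>:
  "full_subgroupoid \<H> \<K> base_inclusion snd subgroupoid_inclusion subgroupoid_coordinates"
proof unfold_locales
  show "continuous_map (obj_top \<K>) (obj_top \<H>) base_inclusion"
    unfolding obj_top_\<H> \<K>_simps by (intro continuous_map_pairedI continuous_map_const[THEN iffD2]) auto
  show "continuous_map (subtopology (obj_top \<H>) (base_inclusion ` objs \<K>)) (obj_top \<K>) snd"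
    unfolding obj_top_\<H> \<K>_simps by (intro continuous_map_from_subtopology continuous_map_snd)
  have "continuous_map (arr_top \<K>) TG fst" "continuous_map (arr_top \<K>) (arr_top \<G>) snd"
    unfolding \<K>_simps using continuous_map_fst continuous_map_snd continuous_map_into_fulltopology by blast+
  then have "continuous_map (arr_top \<K>) (arr_top \<H>) (\<lambda>z. (fst z \<otimes> \<rho> (snd z), N, snd z))"
    unfolding arr_top_\<H> by (intro continuous_map_pairedI continuous_map_mult continuous_map_\<rho>) auto
  then show "continuous_map (arr_top \<K>) (arr_top \<H>) subgroupoid_inclusion"
    by (simp add: case_prod_unfold)
  let ?U = "subtopology (arr_top \<H>) {h. src \<H> h \<in> base_inclusion ` objs \<K> \<and> rng \<H> h \<in> base_inclusion ` objs \<K>}"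
  have "continuous_map ?U TG (\<lambda>z. fst z \<otimes> inv (\<rho> (snd (snd z))))" "continuous_map ?U (arr_top \<G>) (\<lambda>z. snd (snd z))"
    unfolding arr_top_\<H>
    by (intro continuous_map_from_subtopology continuous_map_mult continuous_map_inv continuous_map_\<rho>
        continuous_map_fst continuous_map_components)+
  moreover have "fst z \<otimes> inv (\<rho> (snd (snd z))) \<in> N" if "z \<in> topspace ?U" for z
    using that by (auto simp: \<K>_simps elim!: coordinates_in_N)
  ultimately show "continuous_map ?U (arr_top \<K>) subgroupoid_coordinates"
    by (auto simp: \<K>_simps case_prod_unfold continuous_map_paired continuous_map_in_subtopology)
next
  fix k assume "k \<in> arrows \<K>"
  then obtain n \<gamma> where k: "k = (n, \<gamma>)" "n \<in> N" "\<gamma> \<in> arrows \<G>" 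
    by (cases k) (auto simp: \<K>_simps)
  then show "subgroupoid_coordinates (subgroupoid_inclusion k) = k"
    by (simp add: m_assoc)
  show "src \<K> k \<in> objs \<K>" "rng \<K> k \<in> objs \<K>"
    using k by (simp_all add: \<K>_simps)
  show "src \<H> (subgroupoid_inclusion k) = (N, src \<K> k)" "rng \<H> (subgroupoid_inclusion k) = (N, rng \<K> k)"
    using k by (simp_all add: \<K>_simps subgroupoid_inclusion_base rng_\<H>)
  show "ginv \<K> k = subgroupoid_coordinates (ginv \<H> (subgroupoid_inclusion k))"
    using k by (simp add: twisted_product_groupoid_def crossed_groupoid_def inv_mult_group)
  fix l assume l': "l \<in> arrows \<K>" "src \<K> k = rng \<K> l"
  then obtain m \<gamma>' where l: "l = (m, \<gamma>')" "m \<in> N" "\<gamma>' \<in> arrows \<G>" "src \<G> \<gamma> = rng \<G> \<gamma>'"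
    using k by (cases l) (auto simp: \<K>_simps)
  have c: "inv (\<rho> \<gamma>) \<otimes> (\<rho> \<gamma> \<otimes> x) = x" if "x \<in> carrier G" for x
    using that k by (simp add: assoc_left)
  show "gmult \<K> k l = subgroupoid_coordinates (gmult \<H> (subgroupoid_inclusion k) (subgroupoid_inclusion l))"
    using k l by (simp add: twisted_product_groupoid_def crossed_groupoid_def delta_rho_def m_assoc c)
next
  fix h assume "h \<in> arrows \<H>" "src \<H> h \<in> base_inclusion ` objs \<K>" "rng \<H> h \<in> base_inclusion ` objs \<K>"
  then show "subgroupoid_inclusion (subgroupoid_coordinates h) = h"
    unfolding \<K>_simps by (cases rule: coordinates_in_N) (simp add: m_assoc)
next
  fix x assume "x \<in> objs \<K>"
  then show "ident \<K> x = subgroupoid_coordinates (ident \<H> (N, x))"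
    by (simp add: \<K>_simps twisted_product_groupoid_def crossed_groupoid_def)
qed simp

abbreviation "linking_space \<equiv> prod_topology TG (arr_top \<G>)"
abbreviation "linking_inclusion \<equiv> \<lambda>(g, \<gamma>). (g, N #> (g \<otimes> inv (\<rho> \<gamma>)), \<gamma>)"
abbreviation "linking_coordinates \<equiv> \<lambda>(g, t :: 'g set, \<gamma> :: 'a). (g, \<gamma>)"

text \<open>
The range map \<open>(g, \<gamma>) \<mapsto> (g \<rho>(\<gamma>)\<inverse> N, r \<gamma>)\<close> is the composition of \<open>(g, \<gamma>) \<mapsto> (g \<rho>(\<gamma>)\<inverse>, r \<gamma>)\<close>, which has
the section \<open>(g, x) \<mapsto> (g \<rho>(1\<^sub>x), 1\<^sub>x)\<close>, with the product of the projection \<open>G \<rightarrow> G/N\<close> and the identity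
of \<open>\<G>\<^sub>0\<close>.
\<close>

lemma linking_rng_quotient:
  "quotient_map linking_space (obj_top \<H>) (\<lambda>p. rng \<H> (linking_inclusion p))"
proof -
  have "quotient_map linking_space (prod_topology TG (obj_top \<G>))
      (\<lambda>p. (fst p \<otimes> inv (\<rho> (snd p)), rng \<G> (snd p)))"
  proof (rule quotient_map_section)
    show "continuous_map linking_space (prod_topology TG (obj_top \<G>))
        (\<lambda>p. (fst p \<otimes> inv (\<rho> (snd p)), rng \<G> (snd p)))"
      by (intro continuous_map_pairedI continuous_map_mult continuous_map_inv continuous_map_\<rho>
          \<G>.continuous_map_rng continuous_map_fst continuous_map_snd)
    show "continuous_map (prod_topology TG (obj_top \<G>)) linking_space
        (\<lambda>y. (fst y \<otimes> \<rho> (ident \<G> (snd y)), ident \<G> (snd y)))"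
      by (intro continuous_map_pairedI continuous_map_mult continuous_map_\<rho>
          \<G>.continuous_map_ident continuous_map_fst continuous_map_snd)
  qed (auto simp: topspace_grp m_assoc \<G>.rng_ident)
  moreover have "quotient_map (prod_topology TG (obj_top \<G>)) (obj_top \<H>) (\<lambda>(g, x). (N #> g, x))"
    unfolding obj_top_\<H>
    using quotient_map_prod_left[OF \<G>.locally_compact_objs _ proj_quotient] \<G>.Hausdorff_objs
      \<G>.Hausdorff_arr \<G>.locally_compact_arr by blast
  ultimately have "quotient_map linking_space (obj_top \<H>)
      ((\<lambda>(g, x). (N #> g, x)) \<circ> (\<lambda>p. (fst p \<otimes> inv (\<rho> (snd p)), rng \<G> (snd p))))"
    by (rule quotient_map_compose)
  then show ?thesis
    by (simp add: o_def case_prod_unfold rng_\<H>)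
qed

lemma full_subgroupoid_bimodule_\<K>:
  "full_subgroupoid_bimodule \<H> \<K> base_inclusion snd subgroupoid_inclusion subgroupoid_coordinates
    linking_space linking_inclusion linking_coordinates"
proof -
  interpret full_subgroupoid \<H> \<K> base_inclusion snd subgroupoid_inclusion subgroupoid_coordinates
    by (rule full_subgroupoid_\<K>)
  show ?thesis
  proof unfold_locales
    have "continuous_map linking_space (arr_top \<H>) (\<lambda>p. (fst p, N #> (fst p \<otimes> inv (\<rho> (snd p))), snd p))"
      unfolding arr_top_\<H>
      by (intro continuous_map_pairedI continuous_map_proj continuous_map_mult continuous_map_inv
          continuous_map_\<rho> continuous_map_fst continuous_map_snd)
    then show "continuous_map linking_space (arr_top \<H>) linking_inclusion"
      by (simp add: case_prod_unfold)
    have "continuous_map (arr_top \<H>) linking_space (\<lambda>h. (fst h, snd (snd h)))"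
      unfolding arr_top_\<H> by (intro continuous_map_pairedI continuous_map_fst continuous_map_components)
    then show "continuous_map (subtopology (arr_top \<H>) {h. src \<H> h \<in> base_inclusion ` objs \<K>})
        linking_space linking_coordinates"
      by (simp add: case_prod_unfold continuous_map_from_subtopology)
    show "quotient_map linking_space (obj_top \<H>) (\<lambda>p. rng \<H> (linking_inclusion p))"
      by (rule linking_rng_quotient)
    show "Hausdorff_space (obj_top \<H>)" "Hausdorff_space linking_space" "locally_compact_space linking_space"
      by (simp_all add: obj_top_\<H> Hausdorff_space_prod_topology locally_compact_space_prod_topology
        Hausdorff_grp Hausdorff_coset_top \<G>.Hausdorff_arr locally_compact_grp
        \<G>.locally_compact_arr \<G>.Hausdorff_objs)
  next
    fix p assume "p \<in> topspace linking_space"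
    then obtain g \<gamma> where p: "p = (g, \<gamma>)" "g \<in> carrier G" "\<gamma> \<in> arrows \<G>"
      by (cases p) (auto simp: topspace_grp)
    then show "src \<H> (linking_inclusion p) \<in> base_inclusion ` objs \<K>"
      by (simp add: src_\<H> \<K>_simps assoc_left) (simp add: m_assoc flip: N_eq)
    show "linking_coordinates (linking_inclusion p) = p"
      using p by simp
  next
    fix h assume h': "h \<in> arrows \<H>" "src \<H> h \<in> base_inclusion ` objs \<K>"
    obtain g a \<gamma> where h: "h = (g, N #> a, \<gamma>)" "g \<in> carrier G" "a \<in> carrier G" "\<gamma> \<in> arrows \<G>"
      using h'(1) by (rule arrows_\<H>E)
    then have "N #> (inv g \<otimes> (a \<otimes> \<rho> \<gamma>)) = N"
      using h'(2) by (auto simp: src_\<H> m_assoc)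
    then have "N #> (a \<otimes> \<rho> \<gamma>) = N #> g"
      using h proj_inverse_eq_N_iff by simp
    then have "N #> (a \<otimes> \<rho> \<gamma>) #> inv (\<rho> \<gamma>) = N #> g #> inv (\<rho> \<gamma>)"
      by simp
    then have "N #> a = N #> (g \<otimes> inv (\<rho> \<gamma>))"
      using h by (simp add: proj_mult_right m_assoc)
    then show "linking_inclusion (linking_coordinates h) = h"
      using h by simp
  qed
qed

lemma locally_compact_groupoid_\<K>: "locally_compact_groupoid \<K>"
proof -
  interpret full_subgroupoid \<H> \<K> base_inclusion snd subgroupoid_inclusion subgroupoid_coordinates
    by (rule full_subgroupoid_\<K>)
  show ?thesis
  proof
    show "Hausdorff_space (arr_top \<K>)" "locally_compact_space (arr_top \<K>)"
      by (simp_all add: \<K>_simps Hausdorff_space_prod_topology locally_compact_space_prod_topology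
          Hausdorff_space_subtopology locally_compact_space_closed_subset closed
          Hausdorff_grp \<G>.Hausdorff_arr locally_compact_grp \<G>.locally_compact_arr)
  qed
qed

end

section \<open>The Morita equivalence of twisted groupoids\<close>

lemma (in equivariant_cocycle) chi_eq_psi:
  assumes "k \<in> arrows \<K>" "l \<in> arrows \<K>"
  shows "chi G N \<G> \<rho> \<sigma> \<Lambda> \<beta> (k, l) = \<psi> (subgroupoid_inclusion k, subgroupoid_inclusion l)"
  using assms by (cases k; cases l) (simp add: \<K>_simps chi_def psi_def FactGroup_def proj_mult_right)

theorem theorem11p1:
  fixes \<G> :: "('o, 'a) groupoid"
    and haar :: "'o \<Rightarrow> 'a measure"
    and G :: "'g top_group"
    and N :: "'g set"
    and \<rho>bar :: "'a \<Rightarrow> 'g set"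
    and \<rho> :: "'a \<Rightarrow> 'g"
    and \<sigma> :: "('g set \<times> 'a) \<times> ('g set \<times> 'a) \<Rightarrow> complex"
    and \<Lambda> :: "'g \<times> 'g set \<times> 'a \<Rightarrow> complex"
    and \<beta> :: "'g \<times> 'g \<times> 'g set \<times> 'o \<Rightarrow> complex"
  assumes "haar_groupoid \<G> haar"
    and "locally_compact_group G"
    and "N \<lhd> G" and "closedin (grp_top G) N"
    and "groupoid_to_group_hom \<G> (G Mod N) (coset_top G N) \<rho>bar"
    and "continuous_map (arr_top \<G>) (grp_top G) \<rho>"
    and "\<forall>\<gamma> \<in> arrows \<G>. N #>\<^bsub>G\<^esub> \<rho> \<gamma> = \<rho>bar \<gamma>"
    and "(\<sigma>, \<Lambda>, \<beta>) \<in> equivariant_cocycles2 G (coset_groupoid G N \<G> \<rho>bar) (translate G) (translate G)"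
  shows "psi G \<G> \<rho> \<sigma> \<Lambda> \<beta> \<in> cocycles2 (crossed_groupoid G N \<G> \<rho>) \<and>
    chi G N \<G> \<rho> \<sigma> \<Lambda> \<beta> \<in> cocycles2 (twisted_product_groupoid G N \<G> \<rho>) \<and>
    (\<exists>P :: ('g \<times> 'a, 'g set \<times> 'o, 'g \<times> 'g set \<times> 'a, 'o, 'g \<times> 'a) bimodule.
      twisted_morita_equivalence
        (crossed_groupoid G N \<G> \<rho>) (psi G \<G> \<rho> \<sigma> \<Lambda> \<beta>)
        (twisted_product_groupoid G N \<G> \<rho>) (chi G N \<G> \<rho> \<sigma> \<Lambda> \<beta>) P)"
proof -
  interpret \<G>: haar_groupoid \<G> haar by fact
  interpret equivariant_cocycle G N \<G> \<rho>bar \<rho> \<sigma> \<Lambda> \<beta>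
    using assms by (intro equivariant_cocycle.intro lifted_homomorphism.intro closed_normal_subgroup.intro
        lifted_homomorphism_axioms.intro closed_normal_subgroup_axioms.intro equivariant_cocycle_axioms.intro
        \<G>.locally_compact_groupoid_axioms) auto
  interpret full_subgroupoid_bimodule \<H> \<K> base_inclusion snd subgroupoid_inclusion subgroupoid_coordinates
      linking_space linking_inclusion linking_coordinates
    by (rule full_subgroupoid_bimodule_\<K>)
  have chi: "chi G N \<G> \<rho> \<sigma> \<Lambda> \<beta> \<in> cocycles2 \<K>"
    by (rule cocycle_restrict[OF psi_cocycle chi_eq_psi])
  have "cohomologous_on \<H> \<psi> \<K> (chi G N \<G> \<rho> \<sigma> \<Lambda> \<beta>) linking_bimodule"
    by (rule cohomologous_on_linking[OF psi_cocycle chi_eq_psi])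
  then have "twisted_morita_equivalence \<H> \<psi> \<K> (chi G N \<G> \<rho> \<sigma> \<Lambda> \<beta>) linking_bimodule"
    unfolding twisted_morita_equivalence_def twisted_groupoid_def
    using psi_cocycle chi locally_compact_groupoid_\<H> locally_compact_groupoid_\<K> morita_bimodule_linking
    by blast
  then show ?thesis
    using psi_cocycle chi by blast
qed

end
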